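(* Let $\beta\geq 0$ and let $$J(Y,\beta)=\lim_{T\to\infty}\frac1T\int_0^T\bigg|\prod_{p\leq Y}\Big(1-\frac{1}{p^{1/2+it}}\Big)^{-1}\bigg|^{\beta}dt .$$ Then $$J(Y,\beta)\sim a_\beta\,(e^{\gamma}\log Y)^{\beta^2/4}\qquad\text{as } Y\to\infty,$$ where $$a_\beta=\prod_p\Big(1-\frac1p\Big)^{\beta^2/4}\sum_{m=0}^\infty\frac{d_{\beta/2}(p^m)^2}{p^m}.$$
   Context: Products over $p$ run over primes. $\gamma$ is the Euler–Mascheroni constant. For $\alpha\in\mathbb{R}$, $d_\alpha(n)$ denotes the $n$th Dirichlet series coefficient of $\zeta(s)^\alpha$, i.e. $\zeta(s)^\alpha=\sum_{n\geq1}d_\alpha(n)n^{-s}$ for $\Re(s)>1$; equivalently $d_\alpha$ is multiplicative with $\sum_{m\geq0}d_\alpha(p^m)x^m=(1-x)^{-\alpha}$ for every prime $p$ and $|x|<1$. In the formula for $a_\beta$ the outer product over $p$ is applied to the whole expression $(1-1/p)^{\beta^2/4}\sum_{m\ge0}d_{\beta/2}(p^m)^2p^{-m}$. *)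

theory Defs
  imports
    "HOL-Analysis.Analysis"
    "HOL-Computational_Algebra.Primes"
    "HOL-Library.Landau_Symbols"
begin

text \<open>
  The multiplicative function with $\sum_m d_\alpha(p^m) x^m = (1 - x)^{-\alpha}$ for every
  prime $p$; by the binomial series the coefficients on prime powers are
  $(-1)^m \binom{-\alpha}{m}$. The lemmas below confirm that \<open>divisor_fn \<alpha>\<close> has these
  properties and that they determine it on the positive integers.
\<close>

definition divisor_fn :: "real \<Rightarrow> nat \<Rightarrow> real" where
  "divisor_fn \<alpha> n =
     (if n = 0 then 0
      else \<Prod>p\<in>prime_factors n. (- 1) ^ multiplicity p n * ((- \<alpha>) gchoose multiplicity p n))"

lemma divisor_fn_1: "divisor_fn \<alpha> 1 = 1"
  by (simp add: divisor_fn_def)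

lemma divisor_fn_mult_coprime:
  assumes "coprime m n"
  shows "divisor_fn \<alpha> (m * n) = divisor_fn \<alpha> m * divisor_fn \<alpha> n"
proof (cases "m = 0 \<or> n = 0")
  case True
  then show ?thesis by (auto simp: divisor_fn_def)
next
  case False
  let ?g = "\<lambda>k. (- 1) ^ k * ((- \<alpha>) gchoose k) :: real"
  have disj: "prime_factors m \<inter> prime_factors n = {}"
  proof (rule ccontr)
    assume "prime_factors m \<inter> prime_factors n \<noteq> {}"
    then obtain p where "prime p" "p dvd m" "p dvd n"
      by (auto simp: prime_factors_dvd)
    with assms show False
      by (metis coprime_common_divisor not_prime_unit)
  qed
  have eq_m: "multiplicity p (m * n) = multiplicity p m" if "p \<in> prime_factors m" for p
  proof -
    have "prime p" "p \<notin> prime_factors n" using that disj by auto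
    hence "multiplicity p n = 0"
      using False by (auto simp: prime_factors_dvd not_dvd_imp_multiplicity_0)
    thus ?thesis using False \<open>prime p\<close> by (simp add: prime_elem_multiplicity_mult_distrib)
  qed
  have eq_n: "multiplicity p (m * n) = multiplicity p n" if "p \<in> prime_factors n" for p
  proof -
    have "prime p" "p \<notin> prime_factors m" using that disj by auto
    hence "multiplicity p m = 0"
      using False by (auto simp: prime_factors_dvd not_dvd_imp_multiplicity_0)
    thus ?thesis using False \<open>prime p\<close> by (simp add: prime_elem_multiplicity_mult_distrib)
  qed
  have "divisor_fn \<alpha> (m * n) =
          (\<Prod>p\<in>prime_factors m \<union> prime_factors n. ?g (multiplicity p (m * n)))"
    using False by (simp add: divisor_fn_def prime_factors_product)
  also have "\<dots> = (\<Prod>p\<in>prime_factors m. ?g (multiplicity p (m * n))) *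
                  (\<Prod>p\<in>prime_factors n. ?g (multiplicity p (m * n)))"
    using disj by (intro prod.union_disjoint) auto
  also have "(\<Prod>p\<in>prime_factors m. ?g (multiplicity p (m * n))) = divisor_fn \<alpha> m"
    using False eq_m unfolding divisor_fn_def by (auto intro!: prod.cong)
  also have "(\<Prod>p\<in>prime_factors n. ?g (multiplicity p (m * n))) = divisor_fn \<alpha> n"
    using False eq_n unfolding divisor_fn_def by (auto intro!: prod.cong)
  finally show ?thesis .
qed

lemma divisor_fn_prime_power:
  assumes "prime (p::nat)"
  shows "divisor_fn \<alpha> (p ^ m) = (- 1) ^ m * ((- \<alpha>) gchoose m)"
proof (cases "m = 0")
  case True
  then show ?thesis by (simp add: divisor_fn_def)
next
  case False
  have "p \<noteq> 0" using assms by auto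
  moreover have "prime_factors (p ^ m) = {p}"
    using assms False by (auto simp: prime_factors_dvd prime_dvd_power_iff primes_dvd_imp_eq)
  moreover have "multiplicity p (p ^ m) = m"
    using assms by (simp add: multiplicity_prime_power)
  ultimately show ?thesis by (simp add: divisor_fn_def)
qed

lemma divisor_fn_generating_function:
  assumes "prime (p::nat)" and "\<bar>x\<bar> < 1"
  shows "(\<lambda>m. divisor_fn \<alpha> (p ^ m) * x ^ m) sums (1 - x) powr (- \<alpha>)"
proof -
  have "(\<lambda>m. ((- \<alpha>) gchoose m) * (- x) ^ m) sums (1 + (- x)) powr (- \<alpha>)"
    using assms by (intro gen_binomial_real) auto
  thus ?thesis
    using assms by (simp add: divisor_fn_prime_power power_minus[of x] mult_ac)
qed

lemma powser_zero_imp_coeff_zero: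
  fixes c :: "nat \<Rightarrow> real"
  assumes "\<And>x. \<bar>x\<bar> < 1 \<Longrightarrow> (\<lambda>m. c m * x ^ m) sums 0"
  shows "c n = 0"
proof (induction n rule: less_induct)
  case (less n)
  have "(\<lambda>k. c (k + n) * x ^ k) sums 0" if "x \<noteq> 0" "norm x < 1" for x :: real
  proof -
    have "(\<lambda>m. c m * x ^ m) sums 0" using assms that by simp
    hence "(\<lambda>k. c (k + n) * x ^ (k + n)) sums (0 - (\<Sum>m<n. c m * x ^ m))"
      by (rule sums_split_initial_segment)
    hence "(\<lambda>k. c (k + n) * x ^ (k + n)) sums 0"
      using less by simp
    from sums_mult2[OF this, of "inverse (x ^ n)"] show ?thesis
      using that by (simp add: power_add field_simps)
  qed
  hence "((\<lambda>x::real. 0) \<longlongrightarrow> c (0 + n)) (at 0)"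
    by (intro powser_limit_0_strong[where s = 1 and a = "\<lambda>k. c (k + n)"]) auto
  thus ?case by (simp add: tendsto_const_iff)
qed

lemma divisor_fn_unique:
  fixes f :: "nat \<Rightarrow> real"
  assumes one: "f 1 = 1"
    and mult: "\<And>m n. coprime m n \<Longrightarrow> f (m * n) = f m * f n"
    and gen: "\<And>p x. prime p \<Longrightarrow> \<bar>x\<bar> < 1 \<Longrightarrow>
                (\<lambda>m. f (p ^ m) * x ^ m) sums (1 - x) powr (- \<alpha>)"
    and "n > 0"
  shows "f n = divisor_fn \<alpha> n"
proof -
  have pp: "f (p ^ m) = divisor_fn \<alpha> (p ^ m)" if "prime p" for p m
  proof -
    have "f (p ^ m) - divisor_fn \<alpha> (p ^ m) = 0"
    proof (rule powser_zero_imp_coeff_zero[where c = "\<lambda>m. f (p ^ m) - divisor_fn \<alpha> (p ^ m)"])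
      fix x :: real assume "\<bar>x\<bar> < 1"
      from sums_diff[OF gen[OF that this] divisor_fn_generating_function[OF that this, of \<alpha>]]
      show "(\<lambda>m. (f (p ^ m) - divisor_fn \<alpha> (p ^ m)) * x ^ m) sums 0"
        by (simp add: left_diff_distrib)
    qed
    thus ?thesis by simp
  qed
  show ?thesis
    using \<open>n > 0\<close>
  proof (induction n rule: less_induct)
    case (less n)
    show ?case
    proof (cases "n = 1")
      case True
      then show ?thesis using one divisor_fn_1 by simp
    next
      case False
      then obtain p where p: "prime p" "p dvd n" using prime_factor_nat by blast
      obtain m where m: "n = p ^ multiplicity p n * m" "\<not> p dvd m"
        using multiplicity_decompose'[of n p] less.prems p not_prime_unit by blast
      have "m > 0" using m less.prems by (intro gr0I) auto
      have cop: "coprime (p ^ multiplicity p n) m"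
        using p m by (simp add: prime_imp_coprime)
      have "m < n"
        using m p \<open>m > 0\<close> less.prems
        by (metis dvd_imp_le dvd_triv_right le_neq_implies_less)
      with less.IH \<open>m > 0\<close> have "f m = divisor_fn \<alpha> m" by blast
      hence "f (p ^ multiplicity p n * m) = divisor_fn \<alpha> (p ^ multiplicity p n * m)"
        by (simp only: mult[OF cop] divisor_fn_mult_coprime[OF cop] pp[OF p(1)])
      thus ?thesis using m(1) by simp
    qed
  qed
qed

definition primes_upto :: "real \<Rightarrow> nat set" where
  "primes_upto Y = {p. prime p \<and> real p \<le> Y}"

lemma finite_primes_upto: "finite (primes_upto Y)"
  by (rule finite_subset[of _ "{..nat \<lfloor>Y\<rfloor>}"]) (auto simp: primes_upto_def le_nat_floor)

definition euler_moment_avg :: "real \<Rightarrow> real \<Rightarrow> real \<Rightarrow> real" where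
  "euler_moment_avg Y \<beta> T =
     1 / T * integral {0..T} (\<lambda>t.
       norm (\<Prod>p\<in>primes_upto Y. inverse (1 - 1 / of_nat p powr (1 / 2 + \<i> * complex_of_real t)))
         powr \<beta>)"

definition J :: "real \<Rightarrow> real \<Rightarrow> real" where
  "J Y \<beta> = Lim at_top (euler_moment_avg Y \<beta>)"

text \<open>
  A product over all primes is written as a product over all naturals, in increasing order, with
  factor 1 at the non-primes.
\<close>

definition a_const :: "real \<Rightarrow> real" where
  "a_const \<beta> =
     prodinf (\<lambda>p. if prime p
       then (1 - 1 / real p) powr (\<beta>\<^sup>2 / 4) * (\<Sum>m. (divisor_fn (\<beta> / 2) (p ^ m))\<^sup>2 / real p ^ m)
       else 1)"

end

theory Submission
  imports Defs "HOL-Real_Asymp.Real_Asymp"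
begin

text \<open>
  Each Euler factor to the power \<open>\<beta>\<close> is the squared modulus of the power series
  \<open>(1 - z) powr - (\<beta> / 2)\<close> with \<open>z = p powr - (1 / 2 + \<i> t)\<close>. Truncating these series gives
  trigonometric polynomials converging uniformly in \<open>t\<close>; their frequencies are pairwise distinct
  by unique factorisation, so the means converge to the product over \<open>p \<le> Y\<close> of
  \<open>F(1/p)\<close>, where \<open>F(x)\<close> is the sum of \<open>d(p^m)\<^sup>2 x^m\<close>. Since
  \<open>(1 - x) powr (\<beta>\<^sup>2 / 4) * F(x) = 1 + O(x\<^sup>2)\<close>, the claim reduces to Mertens' third theorem.

  The latter is proved by a Tauberian argument of Karamata type, comparing the measure with mass
  \<open>- ln (1 - 1/p)\<close> at \<open>ln p\<close> to the measure with mass \<open>1/n\<close> at \<open>n\<close>. As the argument \<open>d\<close> decreases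
  to 0, both Laplace transforms are \<open>ln (1/d) + o(1)\<close>: the first because \<open>d * zeta (1 + d)\<close> tends
  to 1, the second because it is \<open>- ln (1 - exp (- d))\<close>. Hence the two measures give
  asymptotically equal mass to \<open>[0, u]\<close>, and for the second one this mass is a harmonic number,
  which is where Euler's constant comes from.
\<close>

section \<open>Mean values\<close>

text \<open>A relation rather than a value, so that existence of the mean is part of every statement
  about it.\<close>

definition has_mean :: "(real \<Rightarrow> real) \<Rightarrow> real \<Rightarrow> bool" where
  "has_mean f L \<longleftrightarrow> ((\<lambda>T. 1 / T * integral {0..T} f) \<longlongrightarrow> L) at_top"

lemma has_mean_cmult:
  assumes "has_mean f L"
  shows "has_mean (\<lambda>t. c * f t) (c * L)"
  using tendsto_mult_left[OF assms[unfolded has_mean_def], of c]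
  unfolding has_mean_def by (simp add: mult.left_commute)

lemma has_mean_sum:
  assumes "finite I" and "\<And>i. i \<in> I \<Longrightarrow> continuous_on UNIV (f i)"
    and "\<And>i. i \<in> I \<Longrightarrow> has_mean (f i) (L i)"
  shows "has_mean (\<lambda>t. \<Sum>i\<in>I. f i t) (\<Sum>i\<in>I. L i)"
proof -
  have "integral {0..T} (\<lambda>t. \<Sum>i\<in>I. f i t) = (\<Sum>i\<in>I. integral {0..T} (f i))" for T
    using assms by (intro integral_sum integrable_continuous_interval)
      (auto intro: continuous_on_subset)
  moreover have "((\<lambda>T. \<Sum>i\<in>I. 1 / T * integral {0..T} (f i)) \<longlongrightarrow> (\<Sum>i\<in>I. L i)) at_top"
    using assms by (intro tendsto_sum) (auto simp: has_mean_def)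
  ultimately show ?thesis
    unfolding has_mean_def by (simp add: sum_distrib_left)
qed

lemma has_mean_cos: "has_mean (\<lambda>t. cos (t * w)) (if w = 0 then 1 else 0)"
proof (cases "w = 0")
  case True
  have "eventually (\<lambda>T. 1 / T * integral {0..T} (\<lambda>t. cos (t * w)) = 1) at_top"
    using eventually_gt_at_top[of 0] by eventually_elim (simp add: True)
  thus ?thesis using True by (simp add: has_mean_def tendsto_eventually)
next
  case False
  have int: "integral {0..T} (\<lambda>t. cos (t * w)) = sin (T * w) / w" if "T > 0" for T
  proof -
    have "((\<lambda>t. cos (t * w)) has_integral (sin (T * w) / w - sin (0 * w) / w)) {0..T}"
      using that False
      by (intro fundamental_theorem_of_calculus)
        (auto intro!: derivative_eq_intros simp flip: has_real_derivative_iff_has_vector_derivative)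
    thus ?thesis by (simp add: integral_unique)
  qed
  have "((\<lambda>T. 1 / T * (sin (T * w) / w)) \<longlongrightarrow> 0) at_top"
  proof (rule tendsto_0_le[where K = 1])
    show "((\<lambda>T. 1 / T * (1 / \<bar>w\<bar>)) \<longlongrightarrow> 0) at_top"
      by (intro tendsto_mult_left_zero tendsto_divide_0[OF tendsto_const])
        (simp add: filterlim_at_top_imp_at_infinity filterlim_ident)
    show "\<forall>\<^sub>F T in at_top. norm (1 / T * (sin (T * w) / w)) \<le> norm (1 / T * (1 / \<bar>w\<bar>)) * 1"
      by (intro always_eventually allI)
        (auto simp: abs_mult abs_divide intro!: mult_left_mono divide_right_mono)
  qed
  moreover have "\<forall>\<^sub>F T in at_top. 1 / T * (sin (T * w) / w) = 1 / T * integral {0..T} (\<lambda>t. cos (t * w))"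
    using eventually_gt_at_top[of 0] by eventually_elim (simp add: int)
  ultimately have "((\<lambda>T. 1 / T * integral {0..T} (\<lambda>t. cos (t * w))) \<longlongrightarrow> 0) at_top"
    by (rule Lim_transform_eventually)
  thus ?thesis using False by (simp add: has_mean_def)
qed

text \<open>Averaging over [0, T] does not increase the supremum norm, so an approximant uniformly
  within e / 3 of g has an average within e / 3 of that of g for every T > 0.\<close>

lemma has_mean_uniform_limit:
  fixes f :: "nat \<Rightarrow> real \<Rightarrow> real"
  assumes cont: "\<And>n. continuous_on UNIV (f n)" and contg: "continuous_on UNIV g"
    and mean: "\<And>n. has_mean (f n) (L n)"
    and unif: "uniform_limit UNIV f g sequentially" and lim: "L \<longlonglongrightarrow> M"
  shows "has_mean g M"
  unfolding has_mean_def
proof (rule tendstoI)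
  fix e :: real assume e: "e > 0"
  have "\<forall>\<^sub>F n in sequentially. dist (L n) M < e / 3 \<and> (\<forall>t\<in>UNIV. dist (f n t) (g t) < e / 3)"
    using e by (intro eventually_conj tendstoD[OF lim] uniform_limitD[OF unif]) auto
  then obtain n where n: "dist (L n) M < e / 3" "\<And>t. dist (f n t) (g t) < e / 3"
    using eventually_happens[of _ sequentially] by auto
  have "\<forall>\<^sub>F T in at_top. dist (1 / T * integral {0..T} (f n)) (L n) < e / 3"
    using e mean[of n] by (intro tendstoD) (auto simp: has_mean_def)
  thus "\<forall>\<^sub>F T in at_top. dist (1 / T * integral {0..T} g) M < e"
    using eventually_gt_at_top[of 0]
  proof eventually_elim
    case (elim T)
    have int: "f n integrable_on {0..T}" "g integrable_on {0..T}"
      using cont contg by (auto intro!: integrable_continuous_interval intro: continuous_on_subset)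
    have "norm (integral {0..T} (\<lambda>t. g t - f n t)) \<le> integral {0..T} (\<lambda>t. e / 3)"
      using int n(2) by (intro integral_norm_bound_integral integrable_diff)
        (auto simp: dist_real_def abs_minus_commute intro: less_imp_le)
    hence "\<bar>integral {0..T} g - integral {0..T} (f n)\<bar> \<le> T * (e / 3)"
      using int elim by (simp add: integral_diff)
    hence "\<bar>1 / T * integral {0..T} g - 1 / T * integral {0..T} (f n)\<bar> \<le> e / 3"
      using elim by (simp add: abs_le_iff field_simps)
    with elim(1) n(1) show ?case unfolding dist_real_def by linarith
  qed
qed

text \<open>Expanding the square gives cosines with frequencies
  \<open>\<theta> i - \<theta> j\<close>. A cosine has mean 0 unless its frequency is 0, and
  injectivity leaves only the diagonal.\<close>

lemma has_mean_trig_poly: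
  fixes c \<theta> :: "'a \<Rightarrow> real"
  assumes I: "finite I" and inj: "inj_on \<theta> I"
  shows "has_mean (\<lambda>t. (norm (\<Sum>i\<in>I. of_real (c i) * cis (- t * \<theta> i)))\<^sup>2) (\<Sum>i\<in>I. (c i)\<^sup>2)"
proof -
  have eq: "(norm (\<Sum>i\<in>I. of_real (c i) * cis (- t * \<theta> i)))\<^sup>2
      = (\<Sum>i\<in>I. \<Sum>j\<in>I. c i * c j * cos (t * (\<theta> i - \<theta> j)))" for t
    unfolding cmod_power2
    by (simp add: power2_eq_square sum_product sum.distrib[symmetric] cos_diff algebra_simps)
  have m: "has_mean (\<lambda>t. \<Sum>i\<in>I. \<Sum>j\<in>I. c i * c j * cos (t * (\<theta> i - \<theta> j)))
     (\<Sum>i\<in>I. \<Sum>j\<in>I. c i * c j * (if \<theta> i - \<theta> j = 0 then 1 else 0))"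
    by (intro has_mean_sum has_mean_cmult has_mean_cos continuous_intros I)
  have "(\<Sum>i\<in>I. \<Sum>j\<in>I. c i * c j * (if \<theta> i - \<theta> j = 0 then 1 else 0)) =
      (\<Sum>i\<in>I. \<Sum>j\<in>I. if i = j then c i * c j else 0)"
    using inj by (intro sum.cong refl) (auto dest: inj_onD)
  also have "\<dots> = (\<Sum>i\<in>I. (c i)\<^sup>2)"
    using I by (simp add: power2_eq_square)
  finally show ?thesis using m unfolding eq by (rule subst)
qed

section \<open>Coefficients of the binomial series\<close>

lemma of_real_gbinomial: "of_real (a gchoose m) = ((of_real a :: complex) gchoose m)"
  by (simp add: gbinomial_prod_rev)

text \<open>The value of \<open>divisor_fn k\<close> at \<open>p ^ m\<close>, which is the same for
  every prime p.\<close>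

definition divisor_coeff :: "real \<Rightarrow> nat \<Rightarrow> real" where
  "divisor_coeff k m = (- 1) ^ m * ((- k) gchoose m)"

lemma divisor_coeff_sums_complex:
  assumes "norm (z :: complex) < 1"
  shows "(\<lambda>m. of_real (divisor_coeff k m) * z ^ m) sums (1 - z) powr of_real (- k)"
proof -
  have "(\<lambda>m. (of_real (- k) gchoose m) * (- z) ^ m) sums (1 + (- z)) powr of_real (- k)"
    using assms by (intro gen_binomial_complex) auto
  thus ?thesis
    by (simp add: divisor_coeff_def of_real_gbinomial power_minus[of z] mult_ac)
qed

lemma divisor_coeff_sums:
  assumes "\<bar>x\<bar> < 1"
  shows "(\<lambda>m. divisor_coeff k m * x ^ m) sums (1 - x) powr (- k)"
  using divisor_fn_generating_function[OF two_is_prime_nat assms, of k]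
  by (simp add: divisor_fn_prime_power divisor_coeff_def)

lemma divisor_coeff_abs_summable:
  assumes "0 \<le> r" "r < 1"
  shows "summable (\<lambda>m. \<bar>divisor_coeff k m\<bar> * r ^ m)"
proof -
  \<comment> \<open>Convergence at a point strictly between r and 1 yields absolute convergence at
    r.\<close>
  have "summable (\<lambda>m. divisor_coeff k m * ((1 + r) / 2) ^ m)"
    using assms by (intro sums_summable[OF divisor_coeff_sums]) auto
  from powser_insidea[OF this, of r] show ?thesis
    using assms by (simp add: abs_mult power_abs)
qed

text \<open>At sqrt r the series converges absolutely; its terms are eventually below 1 in modulus,
  so their squares are eventually dominated by the moduli.\<close>

lemma divisor_coeff_square_summable:
  assumes "0 \<le> r" "r < 1"
  shows "summable (\<lambda>m. (divisor_coeff k m)\<^sup>2 * r ^ m)"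
proof -
  let ?f = "\<lambda>m. \<bar>divisor_coeff k m\<bar> * sqrt r ^ m"
  have f: "summable ?f"
    using assms by (intro divisor_coeff_abs_summable) auto
  have "summable (\<lambda>m. (?f m)\<^sup>2)"
  proof (rule summable_comparison_test_ev[OF _ f])
    have "\<forall>\<^sub>F m in sequentially. ?f m < 1"
      using summable_LIMSEQ_zero[OF f] by (intro order_tendstoD) auto
    thus "\<forall>\<^sub>F m in sequentially. norm ((?f m)\<^sup>2) \<le> ?f m"
    proof eventually_elim
      case (elim m)
      have "?f m \<ge> 0" using assms by simp
      with elim have "?f m * ?f m \<le> ?f m" by (intro mult_left_le) auto
      thus ?case using \<open>?f m \<ge> 0\<close> by (simp add: power2_eq_square)
    qed
  qed
  moreover have "(?f m)\<^sup>2 = (divisor_coeff k m)\<^sup>2 * r ^ m" for m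
    using assms by (simp add: power_mult_distrib power_mult[symmetric] mult.commute[of m])
      (simp add: power_mult)
  ultimately show ?thesis by simp
qed

text \<open>Boundedness is carried through the same induction because the product rule for uniform
  limits asks for bounded limits.\<close>

lemma uniform_limit_prod:
  fixes f :: "'a \<Rightarrow> nat \<Rightarrow> 'b \<Rightarrow> complex"
  assumes "finite S" and "\<And>p. p \<in> S \<Longrightarrow> uniform_limit UNIV (f p) (g p) F"
    and "\<And>p. p \<in> S \<Longrightarrow> bounded (range (g p))"
  shows "uniform_limit UNIV (\<lambda>n t. \<Prod>p\<in>S. f p n t) (\<lambda>t. \<Prod>p\<in>S. g p t) F
    \<and> bounded (range (\<lambda>t. \<Prod>p\<in>S. g p t))"
  using assms
proof (induction S rule: finite_induct)
  case empty
  show ?case by (auto intro: uniform_limit_const)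
next
  case (insert q S)
  obtain B where B: "\<And>t. norm (g q t) \<le> B"
    using insert.prems(2)[of q] by (auto simp: bounded_iff)
  obtain C where C: "\<And>t. norm (\<Prod>p\<in>S. g p t) \<le> C"
    using insert by (auto simp: bounded_iff)
  have "norm (g q t * (\<Prod>p\<in>S. g p t)) \<le> B * C" for t
    unfolding norm_mult using B C by (intro mult_mono) (auto intro: order_trans[OF norm_ge_zero])
  hence "bounded (range (\<lambda>t. g q t * (\<Prod>p\<in>S. g p t)))"
    by (auto intro: boundedI)
  with insert show ?case
    by (auto intro!: uniform_lim_mult)
qed

text \<open>For p > 0 this is p to the power -(1/2 + it) in polar form, which displays the frequency
  \<open>ln p\<close>.\<close>

definition twist :: "nat \<Rightarrow> real \<Rightarrow> complex" where
  "twist p t = of_real (1 / sqrt (real p)) * cis (- t * ln (real p))"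

lemma twist_eq:
  assumes "p > 0"
  shows "1 / of_nat p powr (1 / 2 + \<i> * complex_of_real t) = twist p t"
proof -
  have "of_nat p powr (1 / 2 + \<i> * complex_of_real t) =
      exp ((1 / 2 + \<i> * complex_of_real t) * of_real (ln (real p)))"
    using assms by (simp add: powr_def)
  also have "(1 / 2 + \<i> * complex_of_real t) * of_real (ln (real p)) =
      of_real (ln (sqrt p)) + \<i> * of_real (t * ln (real p))"
    using assms by (simp add: ln_sqrt algebra_simps)
  also have "exp \<dots> = of_real (sqrt p) * cis (t * ln (real p))"
    using assms by (simp add: exp_add cis_conv_exp exp_of_real)
  finally show ?thesis
    by (simp only: twist_def minus_mult_left[symmetric] cis_inverse[symmetric] of_real_divide of_real_1
        of_real_inverse divide_inverse inverse_mult_distrib mult_1_left)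
qed

lemma norm_twist: "norm (twist p t) = 1 / sqrt p"
  by (simp add: twist_def norm_mult norm_divide)

lemma twist_power: "twist p t ^ m = of_real ((1 / sqrt p) ^ m) * cis (- t * (real m * ln (real p)))"
  by (simp add: twist_def power_mult_distrib power_divide Complex.DeMoivre mult_ac)

definition twist_partial :: "real \<Rightarrow> nat \<Rightarrow> nat \<Rightarrow> real \<Rightarrow> complex" where
  "twist_partial k p M t = (\<Sum>m<M. of_real (divisor_coeff k m) * twist p t ^ m)"

text \<open>The modulus of \<open>twist p t\<close> is 1 / sqrt p for every t, so the absolute
  binomial series at that point is a majorant independent of t.\<close>

lemma uniform_limit_twist_partial:
  assumes p: "p > 1"
  shows "uniform_limit UNIV (twist_partial k p) (\<lambda>t. (1 - twist p t) powr of_real (- k)) sequentially"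
    and "bounded (range (\<lambda>t. (1 - twist p t) powr of_real (- k)))"
proof -
  let ?f = "\<lambda>m t. of_real (divisor_coeff k m) * twist p t ^ m :: complex"
  let ?M = "\<lambda>m. \<bar>divisor_coeff k m\<bar> * (1 / sqrt p) ^ m"
  have r: "1 / sqrt p < 1" "1 / sqrt p \<ge> 0" using p by auto
  have le: "norm (?f m t) \<le> ?M m" for m t
    by (simp add: norm_mult norm_power norm_twist)
  have sm: "summable ?M" by (intro divisor_coeff_abs_summable r)
  have eq: "(\<Sum>m. ?f m t) = (1 - twist p t) powr of_real (- k)" for t
    using r by (intro sums_unique[symmetric] divisor_coeff_sums_complex) (simp add: norm_twist)
  have "uniform_limit UNIV (\<lambda>n t. \<Sum>m<n. ?f m t) (\<lambda>t. \<Sum>m. ?f m t) sequentially"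
    by (rule Weierstrass_m_test[OF le sm])
  thus "uniform_limit UNIV (twist_partial k p) (\<lambda>t. (1 - twist p t) powr of_real (- k)) sequentially"
    by (simp only: eq twist_partial_def[abs_def])
  have "norm (\<Sum>m. ?f m t) \<le> suminf ?M" for t
    by (intro norm_suminf_le le sm)
  thus "bounded (range (\<lambda>t. (1 - twist p t) powr of_real (- k)))"
    unfolding eq by (auto intro: boundedI)
qed

lemma continuous_on_twist [continuous_intros]: "continuous_on A (twist p)"
  unfolding twist_def by (intro continuous_intros)

text \<open>The sum is the logarithm of the integer with these prime exponents, so equal sums force
  equal exponents by unique factorisation.\<close>

lemma inj_on_prime_exponents:
  assumes S: "finite S" "\<And>p. p \<in> S \<Longrightarrow> prime (p::nat)"
  shows "inj_on (\<lambda>h. \<Sum>p\<in>S. real (h p) * ln (real p)) (PiE S B)"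
proof (rule inj_onI)
  fix h h' assume h: "h \<in> PiE S B" "h' \<in> PiE S B"
    and eq: "(\<Sum>p\<in>S. real (h p) * ln (real p)) = (\<Sum>p\<in>S. real (h' p) * ln (real p))"
  have ln_prod: "(\<Sum>p\<in>S. real (h p) * ln (real p)) = ln (real (\<Prod>p\<in>S. p ^ h p))" for h :: "nat \<Rightarrow> nat"
    using S by (simp add: ln_prod ln_realpow prime_gt_0_nat)
  have pos: "(\<Prod>p\<in>S. p ^ h p) > 0" for h :: "nat \<Rightarrow> nat"
    using S(2) by (intro prod_pos) (auto simp: prime_gt_0_nat)
  have "(\<Prod>p\<in>S. p ^ h p) = (\<Prod>p\<in>S. p ^ h' p)"
    using eq pos[of h] pos[of h'] unfolding ln_prod by (simp del: of_nat_prod)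
  hence "h p = h' p" if "p \<in> S" for p
    using multiplicity_prod_prime_powers[OF S S(2)[OF that], of h]
      multiplicity_prod_prime_powers[OF S S(2)[OF that], of h'] that by simp
  thus "h = h'" using h by (intro PiE_ext) auto
qed

lemma prod_cis: "finite S \<Longrightarrow> (\<Prod>p\<in>S. cis (f p)) = cis (\<Sum>p\<in>S. f p)"
  by (induction S rule: finite_induct) (auto simp: cis_mult)

text \<open>Multiplying out gives one term for each choice of exponents, and distinct choices have
  distinct frequencies. The squared coefficients recombine into a product over S.\<close>

lemma has_mean_twist_partial:
  assumes S: "finite S" "\<And>p. p \<in> S \<Longrightarrow> prime (p::nat)"
  shows "has_mean (\<lambda>t. (norm (\<Prod>p\<in>S. twist_partial k p M t))\<^sup>2)
    (\<Prod>p\<in>S. \<Sum>m<M. (divisor_coeff k m)\<^sup>2 / real p ^ m)"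
proof -
  define P where "P = PiE S (\<lambda>_. {..<M})"
  define c where "c = (\<lambda>h. \<Prod>p\<in>S. divisor_coeff k (h p) * (1 / sqrt p) ^ h p)"
  define \<theta> where "\<theta> = (\<lambda>h. \<Sum>p\<in>S. real (h p) * ln (real p))"
  have "(\<Prod>p\<in>S. twist_partial k p M t) = (\<Sum>h\<in>P. of_real (c h) * cis (- t * \<theta> h))" for t
  proof -
    have "(\<Prod>p\<in>S. twist_partial k p M t) =
        (\<Sum>h\<in>P. \<Prod>p\<in>S. of_real (divisor_coeff k (h p)) * twist p t ^ h p)"
      unfolding twist_partial_def P_def by (intro prod_sum_PiE S) auto
    also have "\<dots> = (\<Sum>h\<in>P. of_real (c h) * cis (- t * \<theta> h))"
      unfolding c_def \<theta>_def twist_power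
      by (simp add: prod.distrib prod_cis S sum_distrib_left flip: mult.assoc sum_negf)
    finally show ?thesis .
  qed
  moreover have "(\<Sum>h\<in>P. (c h)\<^sup>2) = (\<Prod>p\<in>S. \<Sum>m<M. (divisor_coeff k m)\<^sup>2 / real p ^ m)"
  proof -
    have "(\<Prod>p\<in>S. \<Sum>m<M. (divisor_coeff k m)\<^sup>2 / real p ^ m) =
        (\<Sum>h\<in>P. \<Prod>p\<in>S. (divisor_coeff k (h p))\<^sup>2 / real p ^ h p)"
      unfolding P_def by (intro prod_sum_PiE S) auto
    also have "\<dots> = (\<Sum>h\<in>P. (c h)\<^sup>2)"
      unfolding c_def prod_power_distrib
    proof (intro sum.cong prod.cong refl)
      fix p h
      have "((1 / sqrt (real p)) ^ h p)\<^sup>2 = ((1 / sqrt (real p))\<^sup>2) ^ h p"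
        by (simp flip: power_mult add: mult.commute)
      also have "\<dots> = 1 / real p ^ h p" by (simp add: power_divide)
      finally show "(divisor_coeff k (h p))\<^sup>2 / real p ^ h p =
          (divisor_coeff k (h p) * (1 / sqrt (real p)) ^ h p)\<^sup>2"
        by (simp add: power_mult_distrib)
    qed
    finally show ?thesis ..
  qed
  moreover have "has_mean (\<lambda>t. (norm (\<Sum>h\<in>P. of_real (c h) * cis (- t * \<theta> h)))\<^sup>2) (\<Sum>h\<in>P. (c h)\<^sup>2)"
    using inj_on_prime_exponents[OF S] S unfolding P_def \<theta>_def
    by (intro has_mean_trig_poly finite_PiE) auto
  ultimately show ?thesis by simp
qed

text \<open>The means of the truncated products are known; uniform convergence in t allows the
  truncation length M to tend to infinity.\<close>

lemma euler_moment_avg_tendsto: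
  "(euler_moment_avg Y \<beta> \<longlongrightarrow>
     (\<Prod>p\<in>primes_upto Y. \<Sum>m. (divisor_coeff (\<beta> / 2) m)\<^sup>2 / real p ^ m)) at_top"
proof -
  define S where "S = primes_upto Y"
  define k where "k = \<beta> / 2"
  define g where "g = (\<lambda>t. \<Prod>p\<in>S. (1 - twist p t) powr of_real (- k))"
  have S: "finite S" "\<And>p. p \<in> S \<Longrightarrow> prime p"
    by (simp_all add: S_def finite_primes_upto) (simp add: primes_upto_def)
  have p1: "p > 1" if "p \<in> S" for p
    using S(2)[OF that] by (rule prime_gt_1_nat)
  have ntw: "norm (twist p t) < 1" if "p \<in> S" for p t
    using p1[OF that] by (simp add: norm_twist)
  have nz: "1 - twist p t \<noteq> 0" if "p \<in> S" for p t
    using ntw[OF that, of t] by auto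
  have ul: "uniform_limit UNIV (\<lambda>M t. \<Prod>p\<in>S. twist_partial k p M t) g sequentially"
    and bd: "bounded (range g)"
    using uniform_limit_prod[of S "twist_partial k", OF S(1)
        uniform_limit_twist_partial[OF p1, of _ k]]
    unfolding g_def by blast+
  have bd': "bounded (range (\<lambda>t. norm (g t)))"
    using bd by (auto simp: bounded_iff)
  have cont: "continuous_on UNIV (twist_partial k p M)" for p M
    unfolding twist_partial_def by (intro continuous_intros)
  have contp: "continuous_on UNIV (\<lambda>t. \<Prod>p\<in>S. twist_partial k p M t)" for M
    by (intro continuous_on_prod cont)
  have contg: "continuous_on UNIV g"
    by (rule uniform_limit_theorem[OF _ ul]) (auto simp: contp)
  have "has_mean (\<lambda>t. (norm (g t))\<^sup>2) (\<Prod>p\<in>S. \<Sum>m. (divisor_coeff k m)\<^sup>2 / real p ^ m)"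
  proof (rule has_mean_uniform_limit)
    show "has_mean (\<lambda>t. (norm (\<Prod>p\<in>S. twist_partial k p M t))\<^sup>2)
        (\<Prod>p\<in>S. \<Sum>m<M. (divisor_coeff k m)\<^sup>2 / real p ^ m)" for M
      by (rule has_mean_twist_partial[OF S])
    show "uniform_limit UNIV (\<lambda>M t. (norm (\<Prod>p\<in>S. twist_partial k p M t))\<^sup>2)
        (\<lambda>t. (norm (g t))\<^sup>2) sequentially"
      unfolding power2_eq_square by (intro uniform_lim_mult uniform_limit_norm ul bd')
    show "(\<lambda>M. \<Prod>p\<in>S. \<Sum>m<M. (divisor_coeff k m)\<^sup>2 / real p ^ m)
        \<longlonglongrightarrow> (\<Prod>p\<in>S. \<Sum>m. (divisor_coeff k m)\<^sup>2 / real p ^ m)"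
    proof (intro tendsto_prod summable_LIMSEQ)
      fix p assume "p \<in> S"
      thus "summable (\<lambda>m. (divisor_coeff k m)\<^sup>2 / real p ^ m)"
        using divisor_coeff_square_summable[of "1 / p" k] p1[of p] by (simp add: power_divide)
    qed
  qed (intro continuous_intros contp contg)+
  \<comment> \<open>A real power commutes with the modulus, so each Euler factor to the power
    \<beta> is the squared modulus of a power with exponent - k, where k is half of \<beta>.\<close>
  moreover have "norm (\<Prod>p\<in>S. inverse (1 - 1 / of_nat p powr (1 / 2 + \<i> * complex_of_real t)))
      powr \<beta> = (norm (g t))\<^sup>2" for t
  proof -
    have "norm (\<Prod>p\<in>S. inverse (1 - 1 / of_nat p powr (1 / 2 + \<i> * complex_of_real t)))
        = (\<Prod>p\<in>S. inverse (norm (1 - twist p t)))"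
      unfolding prod_norm[symmetric] norm_inverse using p1
      by (intro prod.cong refl arg_cong[of _ _ inverse])
        (subst twist_eq, auto intro: less_trans[of 0 1])
    also have "\<dots> powr \<beta> = (\<Prod>p\<in>S. inverse (norm (1 - twist p t)) powr \<beta>)"
      by (rule prod_powr_distrib)
    also have "\<dots> = (\<Prod>p\<in>S. (norm (1 - twist p t) powr (- k))\<^sup>2)"
    proof (intro prod.cong refl)
      fix p
      have "(norm (1 - twist p t) powr (- k))\<^sup>2 = norm (1 - twist p t) powr (- k + - k)"
        by (simp only: power2_eq_square powr_add)
      also have "- k + - k = - \<beta>" by (simp add: k_def)
      finally show "inverse (norm (1 - twist p t)) powr \<beta> = (norm (1 - twist p t) powr (- k))\<^sup>2"
        by (simp add: powr_minus inverse_powr)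
    qed
    also have "\<dots> = (norm (g t))\<^sup>2"
      unfolding g_def prod_norm[symmetric] prod_power_distrib
      by (simp add: norm_powr_real_powr')
    finally show ?thesis .
  qed
  ultimately show ?thesis
    unfolding has_mean_def euler_moment_avg_def[abs_def] S_def k_def by simp
qed

section \<open>A Tauberian comparison theorem\<close>

text \<open>A continuous substitute for an indicator function that jumps between a and b, so that
  polynomial approximation applies.\<close>

definition ramp :: "real \<Rightarrow> real \<Rightarrow> real \<Rightarrow> real" where
  "ramp a b x = min 1 (max 0 ((x - a) / (b - a)))"

lemma ramp_bounds: "0 \<le> ramp a b x" "ramp a b x \<le> 1"
  by (auto simp: ramp_def)

lemma ramp_eq_0:
  assumes "a < b" "x \<le> a"
  shows "ramp a b x = 0"
proof -
  have "(x - a) / (b - a) \<le> 0" using assms by (intro divide_nonpos_pos) auto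
  thus ?thesis by (simp add: ramp_def)
qed

lemma ramp_eq_1:
  assumes "a < b" "b \<le> x"
  shows "ramp a b x = 1"
proof -
  have "1 \<le> (x - a) / (b - a)" using assms by simp
  thus ?thesis unfolding ramp_def by linarith
qed

lemma ramp_le:
  assumes "0 < a" "a < b" "0 \<le> x"
  shows "ramp a b x \<le> x / a"
proof (cases "x \<le> a")
  case True
  thus ?thesis using assms ramp_eq_0[of a b x] by simp
next
  case False
  hence "1 \<le> x / a" using assms by simp
  thus ?thesis using ramp_bounds(2)[of a b x] by linarith
qed

text \<open>
  The error bound has to vanish at both ends of \<open>[0, 1]\<close>, as the limiting measure of
  \<open>exp (- d * n)\<close> has density \<open>1 / (x * ln (1 / x))\<close>. So it is not \<open>ramp\<close> itself that is
  approximated by polynomials but its difference from \<open>x\<close> divided by \<open>x * (1 - x)\<close>.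
\<close>

lemma ramp_approx:
  fixes a b e :: real
  assumes "0 < a" "a < b" "b < 1" "0 < e"
  obtains c :: "nat \<Rightarrow> real" and n :: nat where
    "\<And>x. 0 \<le> x \<Longrightarrow> x \<le> 1 \<Longrightarrow> \<bar>ramp a b x - (\<Sum>i\<le>n. c i * x ^ Suc i)\<bar> \<le> e * (x - x\<^sup>2)"
proof -
  \<comment> \<open>Inside the interval this is (ramp a b x - x) / (x * (1 - x)). The maxima alter a
    denominator only where its numerator vanishes, and they keep q continuous at 0 and 1.\<close>
  define q where "q = (\<lambda>x. ramp a b x / max x a - (1 - ramp a b x) / max (1 - x) (1 - b))"
  have "continuous_on {0..1} q"
    unfolding q_def ramp_def using assms by (intro continuous_intros) (auto simp: max_def)
  then obtain Q where Q: "real_polynomial_function Q" "\<And>x. x \<in> {0..1} \<Longrightarrow> \<bar>q x - Q x\<bar> < e"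
    using Stone_Weierstrass_real_polynomial_function[of "{0..1}" q e] assms by blast
  \<comment> \<open>Multiplied by x this becomes the approximant x + x * (1 - x) * Q x, which has no
    constant term; hence the exponents \<open>Suc i\<close>.\<close>
  from Q(1) have "real_polynomial_function (\<lambda>x. 1 + (1 - x) * Q x)"
    by (intro real_polynomial_function.intros(2-4) real_polynomial_function_diff
        real_polynomial_function.intros(1)[OF bounded_linear_ident])
  then obtain c n where cn: "(\<lambda>x. 1 + (1 - x) * Q x) = (\<lambda>x. \<Sum>i\<le>n. c i * x ^ i)"
    unfolding real_polynomial_function_iff_sum by blast
  have "\<bar>ramp a b x - (\<Sum>i\<le>n. c i * x ^ Suc i)\<bar> \<le> e * (x - x\<^sup>2)" if x: "0 \<le> x" "x \<le> 1" for x
  proof -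
    have "(\<Sum>i\<le>n. c i * x ^ Suc i) = x * (\<Sum>i\<le>n. c i * x ^ i)"
      by (simp add: sum_distrib_left mult_ac)
    also have "\<dots> = x * (1 + (1 - x) * Q x)" using cn by (simp add: fun_eq_iff)
    finally have S: "(\<Sum>i\<le>n. c i * x ^ Suc i) = x + x * (1 - x) * Q x" by (simp add: algebra_simps)
    have 1: "ramp a b x / max x a * (x * (1 - x)) = ramp a b x * (1 - x)"
      using ramp_eq_0[of a b x] assms by (cases "x \<le> a") (auto simp: max_def)
    have 2: "(1 - ramp a b x) / max (1 - x) (1 - b) * (x * (1 - x)) = (1 - ramp a b x) * x"
      using ramp_eq_1[of a b x] assms by (cases "b \<le> x") (auto simp: max_def)
    have "x * (1 - x) * q x = ramp a b x * (1 - x) - (1 - ramp a b x) * x"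
      unfolding 1[symmetric] 2[symmetric] q_def by (simp add: algebra_simps)
    hence "ramp a b x = x + x * (1 - x) * q x" by (simp add: algebra_simps)
    hence "\<bar>ramp a b x - (\<Sum>i\<le>n. c i * x ^ Suc i)\<bar> = \<bar>x * (1 - x) * (q x - Q x)\<bar>"
      unfolding S by (simp add: algebra_simps)
    also have "\<dots> = (x * (1 - x)) * \<bar>q x - Q x\<bar>" using x by (simp add: abs_mult)
    also have "\<dots> \<le> (x * (1 - x)) * e" using Q(2)[of x] x by (intro mult_left_mono) auto
    finally show ?thesis by (simp add: power2_eq_square algebra_simps)
  qed
  thus thesis by (rule that)
qed

text \<open>A discrete measure with mass \<open>a n\<close> at \<open>lam n\<close>. Having finitely
  many positions below each bound makes its mass function a finite sum.\<close>

locale laplace_measure =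
  fixes a lam :: "nat \<Rightarrow> real"
  assumes weight_nonneg: "a n \<ge> 0"
    and position_nonneg: "lam n \<ge> 0"
    and finite_positions: "finite {n. lam n \<le> u}"
    and exp_summable: "d > 0 \<Longrightarrow> summable (\<lambda>n. a n * exp (- d * lam n))"
begin

text \<open>The integral of f (exp (- d * t)) against the measure; for the identity f it is the
  Laplace transform at d. Keeping f as a parameter allows its approximation by polynomials.\<close>

definition lap :: "real \<Rightarrow> (real \<Rightarrow> real) \<Rightarrow> real" where
  "lap d f = (\<Sum>n. a n * f (exp (- d * lam n)))"

definition mass :: "real \<Rightarrow> real" where
  "mass u = (\<Sum>n | lam n \<le> u. a n)"

lemma exp_pos_power: "exp (- d * lam n) ^ Suc i = exp (- (real (Suc i) * d) * lam n)"
  by (simp only: exp_of_nat_mult[symmetric]) (simp add: algebra_simps)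

lemma exp_in_unit: "d > 0 \<Longrightarrow> exp (- d * lam n) \<le> 1"
  using position_nonneg[of n] by simp

lemma summable_monom:
  assumes "d > 0"
  shows "summable (\<lambda>n. a n * exp (- d * lam n) ^ Suc i)"
  unfolding exp_pos_power using assms by (intro exp_summable) simp

text \<open>Powers of the exponential only rescale d, so the Laplace transform controls the integral
  of every polynomial without constant term.\<close>

lemma lap_monom: "lap d (\<lambda>x. x ^ Suc i) = lap (real (Suc i) * d) (\<lambda>x. x)"
  unfolding lap_def exp_pos_power ..

lemma poly_sums:
  assumes "d > 0"
  shows "(\<lambda>n. a n * (\<Sum>i\<le>N. c i * exp (- d * lam n) ^ Suc i)) sums (\<Sum>i\<le>N. c i * lap d (\<lambda>x. x ^ Suc i))"
proof -
  have "(\<lambda>n. \<Sum>i\<le>N. c i * (a n * exp (- d * lam n) ^ Suc i)) sums (\<Sum>i\<le>N. c i * lap d (\<lambda>x. x ^ Suc i))"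
    unfolding lap_def by (intro sums_sum sums_mult summable_sums summable_monom assms)
  thus ?thesis by (simp only: sum_distrib_left mult.left_commute)
qed

lemma summable_ramp:
  assumes "d > 0" "0 < r" "r < s"
  shows "summable (\<lambda>n. a n * ramp r s (exp (- d * lam n)))"
proof (rule summable_comparison_test')
  show "summable (\<lambda>n. a n * exp (- d * lam n) / r)"
    by (intro summable_divide exp_summable assms)
  fix n :: nat
  have "a n * ramp r s (exp (- d * lam n)) \<le> a n * (exp (- d * lam n) / r)"
    using assms by (intro mult_left_mono ramp_le weight_nonneg) auto
  thus "norm (a n * ramp r s (exp (- d * lam n))) \<le> a n * exp (- d * lam n) / r"
    using weight_nonneg[of n] ramp_bounds by (simp add: abs_mult)
qed

text \<open>All points exp (- d * lam n) lie in [0, 1], so the pointwise error bound can be summed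
  against the nonnegative weights.\<close>

lemma lap_ramp_approx:
  assumes d: "d > 0" and rs: "0 < r" "r < s"
    and approx: "\<And>x. 0 \<le> x \<Longrightarrow> x \<le> 1 \<Longrightarrow> \<bar>ramp r s x - (\<Sum>i\<le>N. c i * x ^ Suc i)\<bar> \<le> e * (x - x\<^sup>2)"
  shows "\<bar>lap d (ramp r s) - (\<Sum>i\<le>N. c i * lap d (\<lambda>x. x ^ Suc i))\<bar> \<le> e * lap d (\<lambda>x. x - x\<^sup>2)"
proof -
  let ?E = "\<lambda>n. exp (- d * lam n)"
  have s1: "(\<lambda>n. a n * ramp r s (?E n) - a n * (\<Sum>i\<le>N. c i * ?E n ^ Suc i)) sums
     (lap d (ramp r s) - (\<Sum>i\<le>N. c i * lap d (\<lambda>x. x ^ Suc i)))"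
    unfolding lap_def[of d "ramp r s"] by (intro sums_diff summable_sums summable_ramp poly_sums assms)
  have "summable (\<lambda>n. a n * ?E n ^ Suc 0 - a n * ?E n ^ Suc 1)"
    by (intro summable_diff summable_monom d)
  hence s2: "(\<lambda>n. e * (a n * (?E n - (?E n)\<^sup>2))) sums (e * lap d (\<lambda>x. x - x\<^sup>2))"
    unfolding lap_def by (intro sums_mult summable_sums) (simp add: power2_eq_square right_diff_distrib)
  have le: "norm (a n * ramp r s (?E n) - a n * (\<Sum>i\<le>N. c i * ?E n ^ Suc i)) \<le> e * (a n * (?E n - (?E n)\<^sup>2))" for n
  proof -
    have "norm (a n * ramp r s (?E n) - a n * (\<Sum>i\<le>N. c i * ?E n ^ Suc i))
        = a n * \<bar>ramp r s (?E n) - (\<Sum>i\<le>N. c i * ?E n ^ Suc i)\<bar>"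
      using weight_nonneg[of n] by (simp only: right_diff_distrib[symmetric] abs_mult real_norm_def abs_of_nonneg)
    also have "\<dots> \<le> a n * (e * (?E n - (?E n)\<^sup>2))"
      using exp_in_unit[OF d] by (intro mult_left_mono approx weight_nonneg) auto
    finally show ?thesis by (simp only: mult.left_commute)
  qed
  show ?thesis
    using norm_suminf_le[OF le sums_summable[OF s2]] s1 s2 by (simp add: sums_iff)
qed

text \<open>For d = 1 / u the threshold exp (- s) corresponds to position s * u. The ramp is 1 at
  positions up to s * u and 0 from t * u on, hence lies between two indicator functions.\<close>

lemma lap_ramp_bounds:
  assumes "0 < s" "s < t" "u > 0"
  shows "mass (s * u) \<le> lap (1 / u) (ramp (exp (- t)) (exp (- s)))"
    and "lap (1 / u) (ramp (exp (- t)) (exp (- s))) \<le> mass (t * u)"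
proof -
  let ?f = "\<lambda>n. a n * ramp (exp (- t)) (exp (- s)) (exp (- (1 / u) * lam n))"
  have sm: "summable ?f" using assms by (intro summable_ramp) auto
  have "mass (s * u) \<le> (\<Sum>n | lam n \<le> s * u. ?f n)"
    unfolding mass_def
  proof (intro sum_mono)
    fix n assume "n \<in> {n. lam n \<le> s * u}"
    hence "lam n / u \<le> s" using assms by (simp add: field_simps)
    hence "ramp (exp (- t)) (exp (- s)) (exp (- (1 / u) * lam n)) = 1"
      using assms by (intro ramp_eq_1) auto
    thus "a n \<le> ?f n" by simp
  qed
  also have "\<dots> \<le> suminf ?f"
    using sm by (intro sum_le_suminf finite_positions) (auto intro: mult_nonneg_nonneg weight_nonneg ramp_bounds)
  finally show "mass (s * u) \<le> lap (1 / u) (ramp (exp (- t)) (exp (- s)))" by (simp add: lap_def)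
  have "suminf ?f = (\<Sum>n | lam n \<le> t * u. ?f n)"
  proof (intro suminf_finite finite_positions)
    fix n assume "n \<notin> {n. lam n \<le> t * u}"
    hence "lam n / u \<ge> t" using assms by (simp add: field_simps)
    hence "ramp (exp (- t)) (exp (- s)) (exp (- (1 / u) * lam n)) = 0"
      using assms by (intro ramp_eq_0) auto
    thus "?f n = 0" by simp
  qed
  also have "\<dots> \<le> mass (t * u)"
    unfolding mass_def by (intro sum_mono mult_left_le weight_nonneg ramp_bounds)
  finally show "lap (1 / u) (ramp (exp (- t)) (exp (- s))) \<le> mass (t * u)" by (simp add: lap_def)
qed

end

text \<open>Only the difference of the transforms has to converge, so both may diverge as d
  decreases to 0. The bound on x - x^2 keeps the approximation error of the ramp small in spite of
  that.\<close>

locale laplace_pair = A: laplace_measure a lam + B: laplace_measure b mu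
  for a lam b mu :: "nat \<Rightarrow> real" +
  assumes lap_diff: "((\<lambda>d. A.lap d (\<lambda>x. x) - B.lap d (\<lambda>x. x)) \<longlongrightarrow> 0) (at_right 0)"
    and lap_bound: "d > 0 \<Longrightarrow> B.lap d (\<lambda>x. x - x\<^sup>2) \<le> 1"
begin

text \<open>Each monomial contributes the difference of the transforms at (i + 1) * d, which
  decreases to 0 together with d.\<close>

lemma poly_diff_tendsto:
  "((\<lambda>d. (\<Sum>i\<le>N. c i * A.lap d (\<lambda>x. x ^ Suc i)) - (\<Sum>i\<le>N. c i * B.lap d (\<lambda>x. x ^ Suc i))) \<longlongrightarrow> 0) (at_right 0)"
proof -
  have "((\<lambda>d. A.lap d (\<lambda>x. x ^ Suc i) - B.lap d (\<lambda>x. x ^ Suc i)) \<longlongrightarrow> 0) (at_right 0)" for i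
  proof -
    have "filterlim (\<lambda>d::real. real (Suc i) * d) (at_right 0) (at_right 0)"
      by (rule filterlim_times_pos[OF filterlim_ident]) auto
    from filterlim_compose[OF lap_diff this] show ?thesis
      unfolding A.lap_monom B.lap_monom .
  qed
  hence "((\<lambda>d. \<Sum>i\<le>N. c i * (A.lap d (\<lambda>x. x ^ Suc i) - B.lap d (\<lambda>x. x ^ Suc i))) \<longlongrightarrow> (\<Sum>i\<le>N. c i * 0)) (at_right 0)"
    by (intro tendsto_intros)
  thus ?thesis by (simp add: right_diff_distrib sum_subtractf del: power_Suc)
qed

text \<open>Carries \<open>lap_bound\<close> over to the first measure up to a vanishing error, as x
  - x^2 is a polynomial without constant term.\<close>

lemma square_diff_tendsto:
  "((\<lambda>d. A.lap d (\<lambda>x. x - x\<^sup>2) - B.lap d (\<lambda>x. x - x\<^sup>2)) \<longlongrightarrow> 0) (at_right 0)"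
proof -
  define c :: "nat \<Rightarrow> real" where "c = (\<lambda>i. if i = 0 then 1 else - 1)"
  have c: "(\<Sum>i\<le>1. c i * x ^ Suc i) = x - x\<^sup>2" for x
    by (simp add: c_def power2_eq_square)
  have "\<forall>\<^sub>F d in at_right 0. (\<Sum>i\<le>1. c i * A.lap d (\<lambda>x. x ^ Suc i)) - (\<Sum>i\<le>1. c i * B.lap d (\<lambda>x. x ^ Suc i))
      = A.lap d (\<lambda>x. x - x\<^sup>2) - B.lap d (\<lambda>x. x - x\<^sup>2)"
    using eventually_at_right_less[of 0]
  proof eventually_elim
    case (elim d)
    show ?case
      using A.poly_sums[OF elim, where N = 1 and c = c, unfolded c, THEN sums_unique]
        B.poly_sums[OF elim, where N = 1 and c = c, unfolded c, THEN sums_unique]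
      by (simp only: A.lap_def B.lap_def)
  qed
  from Lim_transform_eventually[OF poly_diff_tendsto this] show ?thesis .
qed

lemma ramp_diff_tendsto:
  assumes rs: "0 < r" "r < s" "s < 1"
  shows "((\<lambda>d. A.lap d (ramp r s) - B.lap d (ramp r s)) \<longlongrightarrow> 0) (at_right 0)"
proof (rule tendstoI)
  fix e :: real assume e: "e > 0"
  \<comment> \<open>The errors add up to less than e: e / 8 from the polynomials, and 2 * e / 8 and
    e / 8 from approximating the ramp for the two measures.\<close>
  obtain c N where c: "\<And>x. 0 \<le> x \<Longrightarrow> x \<le> 1 \<Longrightarrow>
      \<bar>ramp r s x - (\<Sum>i\<le>N. c i * x ^ Suc i)\<bar> \<le> e / 8 * (x - x\<^sup>2)"
    using ramp_approx[OF rs, of "e / 8"] e by auto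
  have "\<forall>\<^sub>F d in at_right 0. dist ((\<Sum>i\<le>N. c i * A.lap d (\<lambda>x. x ^ Suc i)) - (\<Sum>i\<le>N. c i * B.lap d (\<lambda>x. x ^ Suc i))) 0 < e / 8"
    using e by (intro tendstoD[OF poly_diff_tendsto]) auto
  moreover have "\<forall>\<^sub>F d in at_right 0. dist (A.lap d (\<lambda>x. x - x\<^sup>2) - B.lap d (\<lambda>x. x - x\<^sup>2)) 0 < 1"
    by (intro tendstoD[OF square_diff_tendsto]) auto
  ultimately show "\<forall>\<^sub>F d in at_right 0. dist (A.lap d (ramp r s) - B.lap d (ramp r s)) 0 < e"
    using eventually_at_right_less[of 0]
  proof eventually_elim
    case (elim d)
    have "A.lap d (\<lambda>x. x - x\<^sup>2) \<le> 2"
      using elim(2) lap_bound[OF elim(3)] unfolding dist_real_def by linarith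
    hence "e / 8 * A.lap d (\<lambda>x. x - x\<^sup>2) \<le> e / 8 * 2" using e by (intro mult_left_mono) auto
    moreover have "e / 8 * B.lap d (\<lambda>x. x - x\<^sup>2) \<le> e / 8 * 1"
      using e lap_bound[OF elim(3)] by (intro mult_left_mono) auto
    ultimately show ?case
      using A.lap_ramp_approx[OF elim(3) rs(1,2) c] B.lap_ramp_approx[OF elim(3) rs(1,2) c] elim(1) e
      unfolding dist_real_def by linarith
  qed
qed

text \<open>Ramps between u and c * u, and between u / c and u, squeeze the first mass at u between
  values of the second at u / c and c * u, up to small errors. With c = exp h this rescaling shifts
  the logarithm only by h.\<close>

theorem mass_tendsto:
  assumes lim: "((\<lambda>u. B.mass u - ln u) \<longlongrightarrow> g) at_top"
  shows "((\<lambda>u. A.mass u - ln u) \<longlongrightarrow> g) at_top"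
proof (rule tendstoI)
  fix e :: real assume "e > 0"
  \<comment> \<open>Three errors of size h arise: from the limit for \<open>B\<close>, from the
    difference of the ramp integrals and from the shift of the logarithm.\<close>
  define h where "h = e / 4"
  have e4: "e = 4 * h" by (simp add: h_def)
  have h: "h > 0" using \<open>e > 0\<close> by (simp add: h_def)
  define c where "c = exp h"
  have c: "c > 1" using h by (simp add: c_def)
  hence c0: "c > 0" and c0': "1 / c > 0" and c1: "1 / c < 1" by auto
  have scale: "\<forall>\<^sub>F u in at_top. dist (B.mass (k * u) - ln (k * u)) g < h" if "k > 0" for k
    using filterlim_tendsto_pos_mult_at_top[OF tendsto_const that filterlim_ident]
      lim tendstoD[OF _ h] filterlim_compose by blast
  have diff: "\<forall>\<^sub>F u in at_top. dist (A.lap (1 / u) (ramp (exp (- t)) (exp (- s))) -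
      B.lap (1 / u) (ramp (exp (- t)) (exp (- s)))) 0 < h" if "0 < s" "s < t" for s t
  proof -
    have "filterlim (\<lambda>u::real. 1 / u) (at_right 0) at_top"
      using filterlim_inverse_at_right_top by (simp add: inverse_eq_divide)
    from filterlim_compose[OF ramp_diff_tendsto this] show ?thesis
      using that h by (intro tendstoD) auto
  qed
  show "\<forall>\<^sub>F u in at_top. dist (A.mass u - ln u) g < e"
    using scale[of c, OF c0] scale[of "1 / c", OF c0'] diff[of 1 c, OF zero_less_one c] diff[of "1 / c" 1, OF c0' c1] eventually_gt_at_top[of 0]
  proof eventually_elim
    case (elim u)
    have lnc: "ln (c * u) = ln u + h" "ln (1 / c * u) = ln u - h"
      using elim(5) c by (simp_all add: ln_mult ln_div c_def)
    have "A.mass (1 * u) \<le> B.mass (c * u) + h"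
      using A.lap_ramp_bounds(1)[of 1 c u] B.lap_ramp_bounds(2)[of 1 c u] elim c
      unfolding dist_real_def by simp
    moreover have "B.mass (1 / c * u) \<le> A.mass (1 * u) + h"
      using B.lap_ramp_bounds(1)[of "1 / c" 1 u] A.lap_ramp_bounds(2)[of "1 / c" 1 u] elim c
      unfolding dist_real_def by simp
    ultimately show ?case
      using elim(1,2) h e4 unfolding dist_real_def lnc mult_1_left by linarith
  qed
qed

end

section \<open>Mertens' third theorem\<close>

lemma zeta_summable: "s > 1 \<Longrightarrow> summable (\<lambda>n. real n powr - s)"
  by (subst summable_real_powr_iff) simp

text \<open>Euler's sieve: the multiples of a new prime q that survive S are q times the survivors
  of S, since no p in S divides q. Removing them multiplies the sum by 1 - q powr - s. The integer 0
  survives only the empty S, and its term is 0.\<close>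

lemma zeta_sieve:
  fixes s :: real
  assumes s: "s > 1" and S: "finite S" "\<And>p. p \<in> S \<Longrightarrow> prime (p::nat)"
  shows "infsum (\<lambda>n. real n powr - s) {n. \<forall>p\<in>S. \<not> p dvd n} =
    (\<Prod>p\<in>S. 1 - real p powr - s) * (\<Sum>n. real n powr - s)"
proof -
  define f where "f = (\<lambda>n. real n powr - s)"
  have summ: "f summable_on A" for A
    using norm_summable_imp_summable_on[of f] zeta_summable[OF s]
    by (auto simp: f_def intro: summable_on_subset_banach)
  have "infsum f {n. \<forall>p\<in>S. \<not> p dvd n} = (\<Prod>p\<in>S. 1 - f p) * suminf f"
    using S
  proof (induction S rule: finite_induct)
    case empty
    have "infsum f UNIV = suminf f"
      using zeta_summable[OF s] by (intro infsumI norm_summable_imp_has_sum) (auto simp: f_def)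
    thus ?case by simp
  next
    case (insert q S)
    let ?A = "\<lambda>S. {n::nat. \<forall>p\<in>S. \<not> p dvd n}"
    have q: "prime q" using insert.prems by auto
    have split: "?A S = ?A (insert q S) \<union> (*) q ` ?A S"
    proof (intro equalityI subsetI)
      fix n assume "n \<in> ?A S"
      thus "n \<in> ?A (insert q S) \<union> (*) q ` ?A S"
        by (cases "q dvd n") (auto elim!: dvdE intro!: imageI)
    next
      fix n assume "n \<in> ?A (insert q S) \<union> (*) q ` ?A S"
      moreover have "\<not> p dvd q" if "p \<in> S" for p
        using that q insert.hyps insert.prems primes_dvd_imp_eq by blast
      ultimately show "n \<in> ?A S"
        using insert.prems by (auto simp: prime_dvd_mult_iff)
    qed
    have disj: "?A (insert q S) \<inter> (*) q ` ?A S = {}" by auto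
    have "infsum f (?A S) = infsum f (?A (insert q S)) + infsum f ((*) q ` ?A S)"
      by (rule trans[OF arg_cong[of _ _ "infsum f", OF split] infsum_Un_disjoint[OF summ summ disj]])
    also have "infsum f ((*) q ` ?A S) = infsum (f \<circ> (*) q) (?A S)"
      using q by (intro infsum_reindex) (auto simp: inj_on_def)
    also have "f \<circ> (*) q = (\<lambda>n. f q * f n)"
      by (simp add: fun_eq_iff f_def powr_mult)
    also have "infsum (\<lambda>n. f q * f n) (?A S) = f q * infsum f (?A S)"
      by (rule infsum_cmult_right')
    finally have "infsum f (?A (insert q S)) = (1 - f q) * infsum f (?A S)"
      unfolding left_diff_distrib by linarith
    with insert show ?case by (simp add: mult_ac)
  qed
  thus ?thesis by (simp add: f_def)
qed

lemma powr_minus_less_1: "prime p \<Longrightarrow> s > 1 \<Longrightarrow> real p powr - s < 1"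
  using prime_gt_1_nat[of p] by (simp add: powr_minus inverse_less_1_iff)

text \<open>After sieving by the primes up to N, the integer 1 survives and every other survivor
  with nonzero term exceeds N. The sieved sum thus lies between 1 and 1 plus a tail of the
  series.\<close>

lemma euler_product:
  fixes s :: real
  assumes s: "s > 1"
  shows "(\<lambda>N. (\<Prod>p | p \<le> N \<and> prime p. 1 - real p powr - s) * (\<Sum>n. real n powr - s)) \<longlonglongrightarrow> 1"
proof -
  define f where "f = (\<lambda>n. real n powr - s)"
  have f: "summable f" "\<And>n. f n \<ge> 0" using zeta_summable[OF s] by (auto simp: f_def)
  have summ: "f summable_on A" for A
    using norm_summable_imp_summable_on[of f] f
    by (auto intro: summable_on_subset_banach)
  let ?S = "\<lambda>N. {p. p \<le> N \<and> prime p}"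
  let ?A = "\<lambda>N. {n::nat. \<forall>p\<in>?S N. \<not> p dvd n}"
  have eq: "infsum f (?A N) = (\<Prod>p\<in>?S N. 1 - real p powr - s) * (\<Sum>n. real n powr - s)" for N
    unfolding f_def by (rule zeta_sieve) (use s in auto)
  have one: "1 \<in> ?A N" for N by auto
  \<comment> \<open>0 is listed for the case N < 2, when no prime has been removed; its term is
    0.\<close>
  have sub: "?A N \<subseteq> {0, 1} \<union> {N<..}" for N
  proof
    fix n assume n: "n \<in> ?A N"
    show "n \<in> {0, 1} \<union> {N<..}"
    proof (cases "n = 0 \<or> n = 1")
      case False
      then obtain p where p: "prime p" "p dvd n" using prime_factor_nat by blast
      hence "p \<le> n" using False by (intro dvd_imp_le) auto
      moreover have "\<not> p \<le> N" using n p by auto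
      ultimately show ?thesis by simp
    qed auto
  qed
  have Z: "infsum f UNIV = suminf f"
    using f by (intro infsumI norm_summable_imp_has_sum) auto
  have tail: "infsum f {N<..} = suminf f - (\<Sum>n\<le>N. f n)" for N
  proof -
    have "infsum f ({..N} \<union> {N<..}) = infsum f {..N} + infsum f {N<..}"
      by (intro infsum_Un_disjoint summ) auto
    moreover have "{..N} \<union> {N<..} = UNIV" by auto
    ultimately show ?thesis using Z by simp
  qed
  have "infsum f {1} \<le> infsum f (?A N)" for N
    by (intro infsum_mono2 summ) (auto simp: f)
  hence lower: "1 \<le> infsum f (?A N)" for N by (simp add: f_def)
  have upper: "infsum f (?A N) \<le> 1 + (suminf f - (\<Sum>n\<le>N. f n))" if "N \<ge> 1" for N
  proof -
    have "infsum f (?A N) \<le> infsum f ({0, 1} \<union> {N<..})"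
      by (intro infsum_mono2 summ sub) (auto simp: f)
    also have "\<dots> = infsum f {0, 1} + infsum f {N<..}"
      using that by (intro infsum_Un_disjoint summ) auto
    also have "infsum f {0, 1} = 1" by (simp add: f_def)
    finally show ?thesis unfolding tail .
  qed
  have "(\<lambda>N. infsum f (?A N)) \<longlonglongrightarrow> 1"
  proof (rule tendsto_sandwich[where f = "\<lambda>_. 1"])
    have "(\<lambda>N. 1 + (suminf f - (\<Sum>n\<le>N. f n))) \<longlonglongrightarrow> 1 + (suminf f - suminf f)"
      by (intro tendsto_intros summable_LIMSEQ' f)
    thus "(\<lambda>N. 1 + (suminf f - (\<Sum>n\<le>N. f n))) \<longlonglongrightarrow> 1" by simp
    show "\<forall>\<^sub>F N in sequentially. infsum f (?A N) \<le> 1 + (suminf f - (\<Sum>n\<le>N. f n))"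
      using eventually_ge_at_top[of 1] by eventually_elim (rule upper)
  qed (use lower in auto)
  thus ?thesis unfolding eq .
qed

text \<open>Comparison of the series with the integral of d * t powr - (1 + d), carried out by
  telescoping n powr - d with the mean value theorem.\<close>

lemma zeta_bounds:
  assumes d: "d > 0"
  shows "1 \<le> d * (\<Sum>n. real n powr - (1 + d))" "d * (\<Sum>n. real n powr - (1 + d)) \<le> 1 + d"
proof -
  define f where "f = (\<lambda>n. real n powr - (1 + d))"
  define g where "g = (\<lambda>n. real (Suc n) powr - d)"
  have f: "summable f" using zeta_summable[of "1 + d"] d by (simp add: f_def)
  have "g \<longlonglongrightarrow> 0" unfolding g_def using d by real_asymp
  from telescope_sums'[OF this] have g: "(\<lambda>n. g n - g (Suc n)) sums 1" by (simp add: g_def)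
  have step: "d * f (Suc (Suc n)) \<le> g n - g (Suc n) \<and> g n - g (Suc n) \<le> d * f (Suc n)" for n
  proof -
    have "\<exists>z. real (Suc n) < z \<and> z < real (Suc (Suc n)) \<and>
        real (Suc (Suc n)) powr - d - real (Suc n) powr - d =
        (real (Suc (Suc n)) - real (Suc n)) * (- d * z powr (- d - 1))"
      by (intro MVT2) (auto intro!: derivative_eq_intros)
    then obtain z where z: "real (Suc n) < z" "z < real (Suc (Suc n))"
      and mvt: "g (Suc n) - g n = (real (Suc (Suc n)) - real (Suc n)) * (- d * z powr (- d - 1))"
      unfolding g_def by metis
    have "- d - 1 = - (1 + d)" by simp
    with mvt have eq: "g n - g (Suc n) = d * z powr - (1 + d)" by simp
    have "real (Suc (Suc n)) powr - (1 + d) \<le> z powr - (1 + d)"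
      "z powr - (1 + d) \<le> real (Suc n) powr - (1 + d)"
      using z d by (auto intro!: powr_mono2')
    thus ?thesis using d unfolding eq f_def by (auto intro!: mult_left_mono)
  qed
  have sf: "summable (\<lambda>n. f (Suc n))" "summable (\<lambda>n. f (Suc (Suc n)))"
    using f summable_Suc_iff[of f] summable_Suc_iff[of "\<lambda>n. f (Suc n)"] by auto
  have f01: "f 0 = 0" "f (Suc 0) = 1" by (simp_all add: f_def)
  \<comment> \<open>The sum from 2 on omits the first term 1 of the series, which produces the
    additional d in the upper bound.\<close>
  have f1: "(\<Sum>n. f (Suc n)) = suminf f" "(\<Sum>n. f (Suc (Suc n))) = suminf f - 1"
    using suminf_split_head[OF f] suminf_split_head[OF sf(1)] f01 by simp_all
  have "suminf (\<lambda>n. g n - g (Suc n)) \<le> (\<Sum>n. d * f (Suc n))"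
    using step g sf by (intro suminf_le) (auto intro: sums_summable summable_mult)
  thus "1 \<le> d * (\<Sum>n. real n powr - (1 + d))"
    using g sf f1 unfolding f_def[symmetric] by (simp add: sums_iff suminf_mult)
  have "(\<Sum>n. d * f (Suc (Suc n))) \<le> suminf (\<lambda>n. g n - g (Suc n))"
    using step g sf by (intro suminf_le) (auto intro: sums_summable summable_mult)
  thus "d * (\<Sum>n. real n powr - (1 + d)) \<le> 1 + d"
    using g sf f1 unfolding f_def[symmetric] by (simp add: sums_iff suminf_mult algebra_simps)
qed

lemma ln_zeta_tendsto:
  "((\<lambda>d. ln (\<Sum>n. real n powr - (1 + d)) + ln d) \<longlongrightarrow> 0) (at_right 0)"
proof (rule tendsto_sandwich)
  let ?Z = "\<lambda>d. \<Sum>n. real n powr - (1 + d)"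
  have eq: "ln (?Z d) + ln d = ln (d * ?Z d)" and pos: "0 < d * ?Z d" if "d > 0" for d
  proof -
    show "0 < d * ?Z d" using zeta_bounds[OF that] by linarith
    hence "?Z d > 0" using that by (simp add: zero_less_mult_iff)
    thus "ln (?Z d) + ln d = ln (d * ?Z d)" using that by (simp add: ln_mult)
  qed
  show "\<forall>\<^sub>F d in at_right 0. 0 \<le> ln (?Z d) + ln d"
    using eventually_at_right_less[of 0]
  proof eventually_elim
    case (elim d)
    show ?case unfolding eq[OF elim] using zeta_bounds[OF elim] by simp
  qed
  show "\<forall>\<^sub>F d in at_right 0. ln (?Z d) + ln d \<le> ln (1 + d)"
    using eventually_at_right_less[of 0]
  proof eventually_elim
    case (elim d)
    show ?case unfolding eq[OF elim] using zeta_bounds[OF elim] pos[OF elim] elim by simp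
  qed
  show "((\<lambda>d::real. ln (1 + d)) \<longlongrightarrow> 0) (at_right 0)" by real_asymp
qed simp

text \<open>The logarithm of the Euler factor of zeta at 1, so that for Y > 1 the mass up to
  \<open>ln Y\<close> is the logarithm of the product in Mertens' theorem.\<close>

definition prime_weight :: "nat \<Rightarrow> real" where
  "prime_weight n = (if prime n then - ln (1 - 1 / n) else 0)"

lemma euler_product_ln:
  fixes s :: real
  assumes s: "s > 1"
  shows "(\<lambda>n. if prime n then - ln (1 - real n powr - s) else 0) sums ln (\<Sum>n. real n powr - s)"
proof -
  define Z where "Z = (\<Sum>n. real n powr - s)"
  have "0 < (s - 1) * Z"
    using zeta_bounds(1)[of "s - 1"] s by (simp add: Z_def)
  hence Z: "Z > 0" using s by (simp add: zero_less_mult_iff)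
  have pos: "1 - real p powr - s > 0" if "prime p" for p
    using powr_minus_less_1[OF that s] by simp
  have "(\<lambda>N. ln Z - ln ((\<Prod>p | p \<le> N \<and> prime p. 1 - real p powr - s) * Z)) \<longlonglongrightarrow> ln Z - ln 1"
    using euler_product[OF s] unfolding Z_def[symmetric]
    by (intro tendsto_intros) auto
  moreover have "ln Z - ln ((\<Prod>p | p \<le> N \<and> prime p. 1 - real p powr - s) * Z) =
      (\<Sum>n\<le>N. if prime n then - ln (1 - real n powr - s) else 0)" for N
  proof -
    have pp: "(\<Prod>p | p \<le> N \<and> prime p. 1 - real p powr - s) > 0"
      using pos by (intro prod_pos) auto
    have "ln (\<Prod>p | p \<le> N \<and> prime p. 1 - real p powr - s) =
        (\<Sum>p | p \<le> N \<and> prime p. ln (1 - real p powr - s))"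
      using pos by (intro ln_prod) (auto dest!: pos)
    also have "\<dots> = (\<Sum>n\<le>N. if prime n then ln (1 - real n powr - s) else 0)"
      by (subst sum.inter_filter[symmetric]) (auto intro: sum.cong)
    also have "\<dots> = - (\<Sum>n\<le>N. if prime n then - ln (1 - real n powr - s) else 0)"
      unfolding sum_negf[symmetric] by (intro sum.cong) auto
    finally show ?thesis
      using ln_mult_pos[OF pp Z] by linarith
  qed
  ultimately show ?thesis by (simp add: sums_def_le Z_def)
qed

section \<open>Comparing the prime measure with the harmonic measure\<close>

lemma minus_ln_bounds:
  assumes "0 \<le> x" "x \<le> (1/2::real)"
  shows "x \<le> - ln (1 - x)" "- ln (1 - x) \<le> x + 2 * x\<^sup>2"
  using ln_one_minus_pos_lower_bound[OF assms] ln_one_minus_pos_upper_bound[of x] assms by auto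

lemma prime_weight_nonneg: "prime_weight n \<ge> 0"
  using prime_gt_1_nat[of n] by (auto simp: prime_weight_def)

lemma prime_weight_le: "prime_weight n \<le> 2 / n"
proof (cases "prime n")
  case True
  hence n: "n \<ge> 2" by (rule prime_ge_2_nat)
  have "- ln (1 - 1 / n) \<le> 1 / n + 2 * (1 / n)\<^sup>2"
    using n by (intro minus_ln_bounds) auto
  also have "2 * (1 / n)\<^sup>2 \<le> 1 / real n"
    using n by (simp add: power2_eq_square field_simps)
  finally show ?thesis using True by (simp add: prime_weight_def)
qed (simp add: prime_weight_def)

lemma weight_exp_eq: "prime_weight n * exp (- d * ln n) = prime_weight n * real n powr - d"
proof (cases "prime n")
  case True
  hence "n > 0" by (rule prime_gt_0_nat)
  thus ?thesis by (simp add: powr_def)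
qed (simp add: prime_weight_def)

lemma weight_summable:
  assumes "d > 0"
  shows "summable (\<lambda>n. prime_weight n * real n powr - d)"
proof (rule summable_comparison_test')
  show "summable (\<lambda>n. 2 * real n powr - (1 + d))"
    using assms by (intro summable_mult zeta_summable) auto
  fix n :: nat
  have "prime_weight n * real n powr - d \<le> 2 / n * real n powr - d"
    by (intro mult_right_mono prime_weight_le) auto
  also have "\<dots> = 2 * real n powr - (1 + d)"
    by (cases "n = 0") (auto simp: powr_diff powr_minus field_simps powr_add)
  finally show "norm (prime_weight n * real n powr - d) \<le> 2 * real n powr - (1 + d)"
    using prime_weight_nonneg by simp
qed

text \<open>At \<open>n = 0\<close> both measures below have mass 0, as \<open>0\<close> is not prime and \<open>1 / 0 = 0\<close>.\<close>

interpretation primes: laplace_measure prime_weight "\<lambda>n. ln (real n)"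
proof
  show "0 \<le> prime_weight n" for n by (rule prime_weight_nonneg)
  show "0 \<le> ln (real n)" for n by (cases "n = 0") auto
  show "finite {n. ln (real n) \<le> u}" for u
  proof (rule finite_subset)
    show "{n. ln (real n) \<le> u} \<subseteq> {..nat \<lfloor>exp u\<rfloor>}"
    proof
      fix n assume "n \<in> {n. ln (real n) \<le> u}"
      hence "n = 0 \<or> real n \<le> exp u"
        by (metis (mono_tags) exp_ln exp_le_cancel_iff of_nat_0_less_iff mem_Collect_eq gr0I)
      thus "n \<in> {..nat \<lfloor>exp u\<rfloor>}" by (auto simp: le_nat_floor)
    qed
  qed simp
  show "summable (\<lambda>n. prime_weight n * exp (- d * ln n))" if "d > 0" for d
    unfolding weight_exp_eq by (rule weight_summable[OF that])
qed

interpretation harmonic: laplace_measure "\<lambda>n. 1 / real n" "\<lambda>n. real n"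
proof
  show "finite {n. real n \<le> u}" for u
    by (rule finite_subset[of _ "{..nat \<lfloor>u\<rfloor>}"]) (auto simp: le_nat_floor)
  fix d :: real assume d: "d > 0"
  have "summable (\<lambda>n. exp (- d) ^ n)" using d by (intro summable_geometric) simp
  hence "summable (\<lambda>n. exp (- d * real n))" by (simp add: exp_of_nat2_mult[symmetric] mult.commute)
  thus "summable (\<lambda>n. 1 / real n * exp (- d * real n))"
    by (rule summable_comparison_test') (auto simp: divide_le_eq)
qed auto

lemma harmonic_lap:
  assumes d: "d > 0"
  shows "harmonic.lap d (\<lambda>x. x) = - ln (1 - exp (- d))"
proof -
  have "(\<lambda>n. - (- ((- (- exp (- d))) ^ n) / real n)) sums - ln (1 + (- exp (- d)))"
    using d by (intro sums_minus ln_series') auto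
  thus ?thesis
    by (simp add: harmonic.lap_def sums_iff exp_of_nat2_mult[symmetric] mult.commute)
qed

text \<open>Since 1 - exp (- d * n) \<le> d * n, the term at n is at most d * exp (- d * n). These
  sum over n \<ge> 1 to d / (exp d - 1), which is at most 1.\<close>

lemma harmonic_bound:
  assumes d: "d > 0"
  shows "harmonic.lap d (\<lambda>x. x - x\<^sup>2) \<le> 1"
proof -
  define E where "E = exp (- d)"
  have E: "0 < E" "E < 1" using d by (auto simp: E_def)
  have e: "exp (- d * real n) = E ^ n" for n
    by (simp add: E_def exp_of_nat2_mult[symmetric] mult.commute)
  have geo: "(\<lambda>n. d * E ^ Suc n) sums (d * (E * (1 / (1 - E))))"
    unfolding power_Suc using E by (intro sums_mult geometric_sums) auto
  have le: "1 / real (Suc n) * (E ^ Suc n - (E ^ Suc n)\<^sup>2) \<le> d * E ^ Suc n" for n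
  proof -
    have "1 - E ^ Suc n \<le> real (Suc n) * d"
      using exp_ge_add_one_self[of "- d * real (Suc n)"] unfolding e by (simp add: algebra_simps)
    hence "E ^ Suc n * (1 - E ^ Suc n) \<le> E ^ Suc n * (real (Suc n) * d)"
      using E by (intro mult_left_mono) auto
    thus ?thesis by (simp add: field_simps power2_eq_square)
  qed
  let ?h = "\<lambda>n. 1 / real n * (E ^ n - (E ^ n)\<^sup>2)"
  have nn: "0 \<le> ?h (Suc n)" for n
    using E power_le_one[of E "Suc n"] by (auto simp: power2_eq_square mult_left_le)
  have sm: "summable (\<lambda>n. ?h (Suc n))"
    by (rule summable_comparison_test'[OF sums_summable[OF geo]])
      (use nn le in \<open>simp only: real_norm_def abs_of_nonneg\<close>)
  have "harmonic.lap d (\<lambda>x. x - x\<^sup>2) = (\<Sum>n. ?h (Suc n))"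
    unfolding harmonic.lap_def e using suminf_split_head[of ?h] sm summable_Suc_iff[of ?h] by simp
  also have "\<dots> \<le> d * (E * (1 / (1 - E)))"
    using suminf_le[OF le sm sums_summable[OF geo]] geo by (simp add: sums_iff)
  also have "\<dots> \<le> 1"
  proof -
    have "1 + d \<le> 1 / E" using exp_ge_add_one_self[of d] by (simp add: E_def exp_minus field_simps)
    thus ?thesis using E by (simp add: field_simps)
  qed
  finally show ?thesis .
qed

text \<open>For n prime, x = 1 / n and y = n powr - d, both quantities lie between x * y and x * y +
  2 * x^2, uniformly in d.\<close>

lemma prime_weight_diff_bound:
  assumes "d > 0"
  shows "\<bar>prime_weight n * real n powr - d - (if prime n then - ln (1 - real n powr - (1 + d)) else 0)\<bar> \<le> 2 / (real n)\<^sup>2"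
proof (cases "prime n")
  case True
  hence n: "n \<ge> 2" by (rule prime_ge_2_nat)
  define x where "x = 1 / real n"
  define y where "y = real n powr - d"
  have x: "0 < x" "x \<le> 1 / 2" using n by (auto simp: x_def)
  have y: "0 < y" "y \<le> 1" using n assms by (auto simp: y_def powr_minus intro!: inverse_le_1_iff[THEN iffD2] ge_one_powr_ge_zero)
  have xy: "real n powr - (1 + d) = x * y"
    using n by (simp add: x_def y_def powr_add powr_minus powr_diff field_simps)
  have xy2: "x * y \<le> x" "0 \<le> x * y" using x y by (auto simp: mult_left_le)
  note b1 = minus_ln_bounds[of x] and b2 = minus_ln_bounds[of "x * y"]
  have "y * x \<le> y * - ln (1 - x)" "y * - ln (1 - x) \<le> y * (x + 2 * x\<^sup>2)"
    using b1 x y by (intro mult_left_mono; simp)+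
  moreover have "y * (x + 2 * x\<^sup>2) \<le> x * y + 2 * x\<^sup>2"
    using x y by (simp add: algebra_simps mult_left_le)
  moreover have "(x * y)\<^sup>2 \<le> x\<^sup>2" using xy2 by (intro power_mono)
  ultimately have "\<bar>y * - ln (1 - x) - (- ln (1 - x * y))\<bar> \<le> 2 * x\<^sup>2"
    using b2 xy2 x unfolding abs_le_iff mult.commute[of y x] by (intro conjI) linarith+
  thus ?thesis using True unfolding xy
    by (simp add: prime_weight_def x_def y_def power_divide mult.commute)
qed (simp add: prime_weight_def)

text \<open>The weights come from the Euler factors at 1, the zeta value from those at 1 + d.
  Tannery's theorem with majorant 2 / n^2 shows that the total discrepancy vanishes.\<close>

lemma prime_lap_tendsto:
  "((\<lambda>d. primes.lap d (\<lambda>x. x) - ln (\<Sum>n. real n powr - (1 + d))) \<longlongrightarrow> 0) (at_right 0)"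
proof -
  let ?t = "\<lambda>n d. prime_weight n * real n powr - d - (if prime n then - ln (1 - real n powr - (1 + d)) else 0)"
  have "((\<lambda>d. suminf (\<lambda>n. ?t n d)) \<longlongrightarrow> (\<Sum>n::nat. 0)) (at_right 0)"
  proof (rule tannerys_theorem[THEN conjunct2, THEN conjunct2])
    show "((\<lambda>d. ?t n d) \<longlongrightarrow> 0) (at_right 0)" for n
    proof (cases "prime n")
      case True
      hence n: "n \<ge> 2" by (rule prime_ge_2_nat)
      have "((\<lambda>d. ?t n d) \<longlongrightarrow> prime_weight n * real n powr - 0 - (if prime n then - ln (1 - real n powr - (1 + 0)) else 0)) (at_right 0)"
        using True n by (simp only: if_True, intro tendsto_intros) (simp_all add: powr_minus)
      thus ?thesis using True n by (simp add: prime_weight_def powr_minus divide_inverse)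
    qed (simp add: prime_weight_def)
    show "\<forall>\<^sub>F (n, d) in sequentially \<times>\<^sub>F at_right 0. norm (?t n d) \<le> 2 / (real n)\<^sup>2"
      unfolding eventually_prod_filter
      using prime_weight_diff_bound eventually_at_right_less[of 0]
      by (intro exI[of _ "\<lambda>_. True"] exI[of _ "\<lambda>d. 0 < d"]) auto
    show "summable (\<lambda>n. 2 / (real n)\<^sup>2)"
      using inverse_power_summable[of 2] by (simp add: summable_mult divide_inverse)
  qed simp
  moreover have "\<forall>\<^sub>F d in at_right 0. suminf (\<lambda>n. ?t n d) = primes.lap d (\<lambda>x. x) - ln (\<Sum>n. real n powr - (1 + d))"
    using eventually_at_right_less[of 0]
  proof eventually_elim
    case (elim d)
    have "(\<lambda>n. prime_weight n * real n powr - d) sums primes.lap d (\<lambda>x. x)"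
      unfolding primes.lap_def weight_exp_eq using weight_summable[OF elim] by (rule summable_sums)
    from sums_diff[OF this euler_product_ln[of "1 + d"]] elim show ?case
      by (simp add: sums_iff)
  qed
  ultimately show ?thesis by (simp add: tendsto_cong)
qed

text \<open>The transform of the prime measure is ln (zeta (1 + d)) + o(1), and both ln (zeta (1 +
  d)) and - ln (1 - exp (- d)) are - ln d + o(1).\<close>

interpretation primes_harmonic: laplace_pair prime_weight "\<lambda>n. ln (real n)" "\<lambda>n. 1 / real n" "\<lambda>n. real n"
proof
  show "((\<lambda>d. primes.lap d (\<lambda>x. x) - harmonic.lap d (\<lambda>x. x)) \<longlongrightarrow> 0) (at_right 0)"
  proof -
    have "((\<lambda>d::real. ln (1 - exp (- d)) - ln d) \<longlongrightarrow> 0) (at_right 0)" by real_asymp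
    from tendsto_add[OF tendsto_add[OF prime_lap_tendsto ln_zeta_tendsto] this]
    have "((\<lambda>d. primes.lap d (\<lambda>x. x) + ln (1 - exp (- d))) \<longlongrightarrow> 0) (at_right 0)" by simp
    moreover have "\<forall>\<^sub>F d in at_right 0. primes.lap d (\<lambda>x. x) + ln (1 - exp (- d)) =
        primes.lap d (\<lambda>x. x) - harmonic.lap d (\<lambda>x. x)"
      using eventually_at_right_less[of 0] by eventually_elim (simp add: harmonic_lap)
    ultimately show ?thesis by (rule Lim_transform_eventually)
  qed
qed (rule harmonic_bound)

text \<open>The mass up to u is a harmonic number with index floor u, and replacing the logarithm of
  floor u by ln u costs o(1).\<close>

lemma harmonic_mass_tendsto: "((\<lambda>u. harmonic.mass u - ln u) \<longlongrightarrow> euler_mascheroni) at_top"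
proof -
  have "((\<lambda>u. harm (nat \<lfloor>u\<rfloor>) - ln (real (nat \<lfloor>u\<rfloor>))) \<longlongrightarrow> euler_mascheroni) at_top"
    by (rule filterlim_compose[OF euler_mascheroni_LIMSEQ])
      (rule filterlim_compose[OF filterlim_nat_sequentially filterlim_floor_sequentially])
  moreover have "((\<lambda>u::real. ln (of_int \<lfloor>u\<rfloor>) - ln u) \<longlongrightarrow> 0) at_top" by real_asymp
  ultimately have "((\<lambda>u. (harm (nat \<lfloor>u\<rfloor>) - ln (real (nat \<lfloor>u\<rfloor>))) + (ln (of_int \<lfloor>u\<rfloor>) - ln u))
      \<longlongrightarrow> euler_mascheroni + 0) at_top"
    by (rule tendsto_add)
  moreover have "\<forall>\<^sub>F u in at_top. (harm (nat \<lfloor>u\<rfloor>) - ln (real (nat \<lfloor>u\<rfloor>))) + (ln (of_int \<lfloor>u\<rfloor>) - ln u)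
      = harmonic.mass u - ln (u::real)"
    using eventually_ge_at_top[of 0]
  proof eventually_elim
    case (elim u)
    have "harmonic.mass u = (\<Sum>n\<in>{..nat \<lfloor>u\<rfloor>}. 1 / real n)"
      unfolding harmonic.mass_def using elim by (intro sum.cong) (auto simp: le_nat_floor le_nat_iff le_floor_iff)
    also have "\<dots> = harm (nat \<lfloor>u\<rfloor>)"
      unfolding harm_def by (intro sum.mono_neutral_cong_right) (auto simp: inverse_eq_divide)
    finally show ?case using elim by simp
  qed
  ultimately show ?thesis using Lim_transform_eventually by fastforce
qed

text \<open>The prime p sits at ln p, so the primes up to Y are reached by taking u = ln Y in the
  Tauberian comparison.\<close>

theorem mertens_third:
  "((\<lambda>Y. (\<Sum>p\<in>primes_upto Y. - ln (1 - 1 / real p)) - ln (ln Y)) \<longlongrightarrow> euler_mascheroni) at_top"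
proof -
  have "((\<lambda>Y. primes.mass (ln Y) - ln (ln Y)) \<longlongrightarrow> euler_mascheroni) at_top"
    by (rule filterlim_compose[OF primes_harmonic.mass_tendsto[OF harmonic_mass_tendsto] ln_at_top])
  moreover have "\<forall>\<^sub>F Y in at_top. primes.mass (ln Y) - ln (ln Y) =
      (\<Sum>p\<in>primes_upto Y. - ln (1 - 1 / real p)) - ln (ln Y)"
    using eventually_gt_at_top[of 1]
  proof eventually_elim
    case (elim Y)
    have "primes.mass (ln Y) = (\<Sum>p\<in>primes_upto Y. - ln (1 - 1 / real p))"
      unfolding primes.mass_def
    proof (rule sum.mono_neutral_cong_right)
      show "finite {n. ln (real n) \<le> ln Y}" by (rule primes.finite_positions)
      show "primes_upto Y \<subseteq> {n. ln (real n) \<le> ln Y}"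
        using elim prime_gt_0_nat by (auto simp: primes_upto_def)
      show "\<forall>n\<in>{n. ln (real n) \<le> ln Y} - primes_upto Y. prime_weight n = 0"
        using elim prime_gt_0_nat by (auto simp: primes_upto_def prime_weight_def)
    qed (auto simp: primes_upto_def prime_weight_def)
    thus ?case by simp
  qed
  ultimately show ?thesis by (rule Lim_transform_eventually)
qed

section \<open>Local factors\<close>

text \<open>Beyond the linear terms x^2 factors out, and the remaining series is bounded on [0, 1/2]
  by its absolute sum at 1/2.\<close>

lemma power_series_second_order:
  fixes c :: "nat \<Rightarrow> real"
  assumes "\<And>x. \<bar>x\<bar> < 1 \<Longrightarrow> summable (\<lambda>m. c m * x ^ m)"
  obtains K where "K \<ge> 0"
    "\<And>x. 0 \<le> x \<Longrightarrow> x \<le> 1 / 2 \<Longrightarrow> \<bar>(\<Sum>m. c m * x ^ m) - (c 0 + c 1 * x)\<bar> \<le> K * x\<^sup>2"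
proof
  have half: "summable (\<lambda>m. norm (c m * (1 / 2) ^ m))"
    by (rule powser_insidea[of c "3/4"]) (use assms[of "3/4"] in auto)
  have *: "summable (\<lambda>m. c (m + 2) * x ^ m)" if "\<bar>x\<bar> < 1" "x \<noteq> 0" for x
  proof -
    have "summable (\<lambda>m. inverse (x ^ 2) * (c (m + 2) * x ^ (m + 2)))"
      using assms[OF that(1)] by (intro summable_mult) (subst summable_iff_shift)
    thus ?thesis using that by (simp add: power_add field_simps)
  qed
  \<comment> \<open>Any point strictly between 1/2 and 1 would serve in place of 3/4.\<close>
  have abs_half: "summable (\<lambda>m. norm (c (m + 2) * (1 / 2) ^ m))"
    by (rule powser_insidea[of "\<lambda>m. c (m + 2)" "3/4"]) (use *[of "3/4"] in auto)
  let ?K = "\<Sum>m. norm (c (m + 2) * (1 / 2) ^ m)"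
  show "?K \<ge> 0" by (intro suminf_nonneg abs_half) auto
  fix x :: real assume x: "0 \<le> x" "x \<le> 1 / 2"
  show "\<bar>(\<Sum>m. c m * x ^ m) - (c 0 + c 1 * x)\<bar> \<le> ?K * x\<^sup>2"
  proof (cases "x = 0")
    case True
    thus ?thesis by (simp add: powser_zero)
  next
    case False
    have sm: "summable (\<lambda>m. c (m + 2) * x ^ m)" using x False by (intro *) auto
    have "(\<Sum>m. c m * x ^ m) = (\<Sum>m. c (m + 2) * x ^ (m + 2)) + (\<Sum>m<2. c m * x ^ m)"
      using x by (intro suminf_split_initial_segment assms) auto
    also have "(\<Sum>m. c (m + 2) * x ^ (m + 2)) = (\<Sum>m. c (m + 2) * x ^ m) * x\<^sup>2"
      by (subst suminf_mult2[OF sm]) (simp add: power_add mult_ac power2_eq_square)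
    finally have eq: "(\<Sum>m. c m * x ^ m) - (c 0 + c 1 * x) = (\<Sum>m. c (m + 2) * x ^ m) * x\<^sup>2"
      by (simp add: numeral_2_eq_2)
    have "norm (\<Sum>m. c (m + 2) * x ^ m) \<le> ?K"
      using x by (intro norm_suminf_le abs_half) (auto simp: abs_mult intro!: mult_left_mono power_mono)
    thus ?thesis unfolding eq by (simp add: abs_mult mult_right_mono)
  qed
qed

lemma divisor_coeff_0: "divisor_coeff k 0 = 1" and divisor_coeff_1: "divisor_coeff k (Suc 0) = k"
  by (simp_all add: divisor_coeff_def)

text \<open>At x = 1 / p and k = \<beta> / 2 this is both the factor at p of the mean value and the
  inner series of \<open>a_const\<close>.\<close>

definition local_sum :: "real \<Rightarrow> real \<Rightarrow> real" where
  "local_sum k x = (\<Sum>m. (divisor_coeff k m)\<^sup>2 * x ^ m)"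

lemma local_sum_ge_1:
  assumes "0 \<le> x" "x < 1"
  shows "local_sum k x \<ge> 1"
proof -
  have "(\<Sum>m<1. (divisor_coeff k m)\<^sup>2 * x ^ m) \<le> local_sum k x"
    unfolding local_sum_def using assms
    by (intro sum_le_suminf divisor_coeff_square_summable) auto
  thus ?thesis by (simp add: divisor_coeff_0)
qed

text \<open>The exponent \<open>k\<^sup>2\<close> is the one that cancels the linear term of the local sum.\<close>

lemma local_factor_second_order:
  obtains K where "\<And>x. 0 \<le> x \<Longrightarrow> x \<le> 1 / 2 \<Longrightarrow> \<bar>(1 - x) powr k\<^sup>2 * local_sum k x - 1\<bar> \<le> K * x\<^sup>2"
proof -
  have "summable (\<lambda>m. (divisor_coeff k m)\<^sup>2 * x ^ m)" if "\<bar>x\<bar> < 1" for x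
    by (rule summable_norm_cancel)
      (use divisor_coeff_square_summable[of "\<bar>x\<bar>" k] that in \<open>simp add: abs_mult power_abs\<close>)
  then obtain K1 where K1: "K1 \<ge> 0"
    "\<And>x. 0 \<le> x \<Longrightarrow> x \<le> 1 / 2 \<Longrightarrow> \<bar>local_sum k x - (1 + k\<^sup>2 * x)\<bar> \<le> K1 * x\<^sup>2"
    using power_series_second_order[of "\<lambda>m. (divisor_coeff k m)\<^sup>2"]
    by (auto simp: divisor_coeff_0 divisor_coeff_1 local_sum_def)
  \<comment> \<open>With parameter - k^2 the same coefficients expand (1 - x) powr k^2, whose linear
    coefficient is - k^2.\<close>
  have "summable (\<lambda>m. divisor_coeff (- k\<^sup>2) m * x ^ m)" if "\<bar>x\<bar> < 1" for x
    using divisor_coeff_sums[OF that] by (rule sums_summable)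
  then obtain K2 where K2: "K2 \<ge> 0"
    "\<And>x. 0 \<le> x \<Longrightarrow> x \<le> 1 / 2 \<Longrightarrow> \<bar>(\<Sum>m. divisor_coeff (- k\<^sup>2) m * x ^ m) - (1 - k\<^sup>2 * x)\<bar> \<le> K2 * x\<^sup>2"
    using power_series_second_order[of "divisor_coeff (- k\<^sup>2)"]
    by (auto simp: divisor_coeff_0 divisor_coeff_1)
  have "\<bar>(1 - x) powr k\<^sup>2 * local_sum k x - 1\<bar> \<le> (k ^ 4 + (1 + k\<^sup>2) * K1 + K2 * (1 + k\<^sup>2 + K1)) * x\<^sup>2"
    if x: "0 \<le> x" "x \<le> 1 / 2" for x
  proof -
    define u where "u = local_sum k x - (1 + k\<^sup>2 * x)"
    define v where "v = (1 - x) powr k\<^sup>2 - (1 - k\<^sup>2 * x)"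
    have x2: "x\<^sup>2 \<le> 1" "x \<le> 1" using x power_mono[of x 1 2] by auto
    have u: "\<bar>u\<bar> \<le> K1 * x\<^sup>2" using K1(2)[OF x] by (simp add: u_def)
    have v: "\<bar>v\<bar> \<le> K2 * x\<^sup>2"
      using K2(2)[OF x] divisor_coeff_sums[of x "- k\<^sup>2"] x by (simp add: v_def sums_iff)
    have "(1 - x) powr k\<^sup>2 * local_sum k x - 1 = (1 - k\<^sup>2 * x + v) * (1 + k\<^sup>2 * x + u) - 1"
      by (simp add: u_def v_def)
    \<comment> \<open>The linear terms have cancelled; what remains is O(x^2) because u and v
      are.\<close>
    also have "\<dots> = - (k ^ 4 * x\<^sup>2) + (1 - k\<^sup>2 * x) * u + v * (1 + k\<^sup>2 * x + u)"
      by (simp add: algebra_simps power2_eq_square power4_eq_xxxx)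
    also have "\<bar>\<dots>\<bar> \<le> \<bar>k ^ 4 * x\<^sup>2\<bar> + \<bar>(1 - k\<^sup>2 * x) * u\<bar> + \<bar>v * (1 + k\<^sup>2 * x + u)\<bar>"
      by linarith
    also have "\<dots> \<le> k ^ 4 * x\<^sup>2 + (1 + k\<^sup>2) * (K1 * x\<^sup>2) + (K2 * x\<^sup>2) * (1 + k\<^sup>2 + K1)"
    proof (intro add_mono)
      have kx: "0 \<le> k\<^sup>2 * x" "k\<^sup>2 * x \<le> k\<^sup>2" using x x2 by (auto intro!: mult_left_le)
      show "\<bar>(1 - k\<^sup>2 * x) * u\<bar> \<le> (1 + k\<^sup>2) * (K1 * x\<^sup>2)"
        unfolding abs_mult using u kx by (intro mult_mono) (auto simp: abs_le_iff)
      have "K1 * x\<^sup>2 \<le> K1" using K1(1) x2 by (intro mult_left_le) auto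
      hence "\<bar>1 + k\<^sup>2 * x + u\<bar> \<le> 1 + k\<^sup>2 + K1" using kx u by linarith
      thus "\<bar>v * (1 + k\<^sup>2 * x + u)\<bar> \<le> (K2 * x\<^sup>2) * (1 + k\<^sup>2 + K1)"
        unfolding abs_mult using v K2(1) by (intro mult_mono) auto
    qed auto
    also have "\<dots> = (k ^ 4 + (1 + k\<^sup>2) * K1 + K2 * (1 + k\<^sup>2 + K1)) * x\<^sup>2"
      by (simp add: algebra_simps)
    finally show ?thesis .
  qed
  thus thesis by (rule that)
qed

section \<open>Convergence of the product for \<open>a_const\<close>\<close>

definition local_factor :: "real \<Rightarrow> nat \<Rightarrow> real" where
  "local_factor k p = (if prime p then (1 - 1 / real p) powr k\<^sup>2 * local_sum k (1 / real p) else 1)"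

lemma local_factor_pos: "local_factor k p > 0"
proof (cases "prime p")
  case True
  hence p: "1 - 1 / real p > 0" "1 / real p \<ge> 0" using prime_gt_1_nat[of p] by auto
  hence "local_sum k (1 / real p) \<ge> 1" by (intro local_sum_ge_1) auto
  with p have "(1 - 1 / real p) powr k\<^sup>2 * local_sum k (1 / real p) > 0"
    by (intro mult_pos_pos) auto
  thus ?thesis using True by (simp add: local_factor_def)
qed (simp add: local_factor_def)

text \<open>The factors differ from 1 by O(1 / p^2), which is summable, and none of them
  vanishes.\<close>

lemma local_factor_convergent: "convergent_prod (local_factor k)"
proof -
  obtain K where K: "\<And>x. 0 \<le> x \<Longrightarrow> x \<le> 1 / 2 \<Longrightarrow> \<bar>(1 - x) powr k\<^sup>2 * local_sum k x - 1\<bar> \<le> K * x\<^sup>2"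
    using local_factor_second_order[of k] by blast
  \<comment> \<open>Evaluation at 1/2 forces K to be nonnegative, as the bound at non-primes
    requires.\<close>
  have "0 \<le> K * (1 / 2)\<^sup>2" using order_trans[OF abs_ge_zero K[of "1 / 2"]] by simp
  hence K0: "K \<ge> 0" by (simp add: zero_le_mult_iff)
  have "\<bar>local_factor k p - 1\<bar> \<le> K * inverse (real p ^ 2)" for p
  proof (cases "prime p")
    case True
    hence "1 / real p \<le> 1 / 2" using prime_ge_2_nat[of p] by (intro divide_left_mono) auto
    thus ?thesis using K[of "1 / real p"] True
      by (simp add: local_factor_def power_divide inverse_eq_divide)
  qed (use K0 in \<open>simp add: local_factor_def\<close>)
  hence "summable (\<lambda>p. \<bar>local_factor k p - 1\<bar>)"
    by (intro summable_comparison_test'[OF summable_mult[OF inverse_power_summable[of 2]]]) auto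
  moreover have "local_factor k p - 1 \<noteq> - 1" for p
    using local_factor_pos[of k p] by simp
  ultimately have "convergent_prod (\<lambda>p. 1 + (local_factor k p - 1))"
    by (rule summable_imp_convergent_prod_real)
  thus ?thesis by simp
qed

lemma a_const_eq: "a_const \<beta> = prodinf (local_factor (\<beta> / 2))"
  unfolding a_const_def local_factor_def local_sum_def
  by (rule arg_cong[of _ _ prodinf])
    (auto simp: fun_eq_iff divisor_fn_prime_power divisor_coeff_def power_divide)

text \<open>A convergent product without zero factors has a nonzero value. This permits division by
  \<open>a_const\<close> in the final quotient.\<close>

lemma a_const_nonzero: "a_const \<beta> \<noteq> 0"
  unfolding a_const_eq
  by (intro prodinf_nonzero local_factor_convergent less_imp_neq[OF local_factor_pos, symmetric])

lemma local_factor_prod_tendsto: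
  "((\<lambda>Y. \<Prod>p\<in>primes_upto Y. local_factor (\<beta> / 2) p) \<longlongrightarrow> a_const \<beta>) at_top"
proof -
  have lim: "((\<lambda>Y. \<Prod>p\<le>nat \<lfloor>Y\<rfloor>. local_factor (\<beta> / 2) p) \<longlongrightarrow> a_const \<beta>) at_top"
    unfolding a_const_eq
    by (rule filterlim_compose[OF convergent_prod_LIMSEQ[OF local_factor_convergent]])
      (rule filterlim_compose[OF filterlim_nat_sequentially filterlim_floor_sequentially])
  have eq: "(\<Prod>p\<le>nat \<lfloor>Y\<rfloor>. local_factor (\<beta> / 2) p) = (\<Prod>p\<in>primes_upto Y. local_factor (\<beta> / 2) p)" for Y
  proof (rule prod.mono_neutral_right)
    show "primes_upto Y \<subseteq> {..nat \<lfloor>Y\<rfloor>}" by (auto simp: primes_upto_def le_nat_floor)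
    show "\<forall>p\<in>{..nat \<lfloor>Y\<rfloor>} - primes_upto Y. local_factor (\<beta> / 2) p = 1"
    proof
      fix p assume p: "p \<in> {..nat \<lfloor>Y\<rfloor>} - primes_upto Y"
      have "\<not> prime p"
      proof
        assume "prime p"
        \<comment> \<open>Positivity of p rules out a negative Y, for which \<open>nat\<close>
          truncates the floor to 0.\<close>
        moreover from this have "p > 0" by (rule prime_gt_0_nat)
        ultimately show False using p by (auto simp: primes_upto_def le_nat_iff le_floor_iff not_le) linarith
      qed
      thus "local_factor (\<beta> / 2) p = 1" by (simp add: local_factor_def)
    qed
  qed simp
  show ?thesis
    by (rule Lim_transform_eventually[OF lim]) (intro always_eventually allI eq)
qed

section \<open>The asymptotic formula\<close>

lemma J_eq: "J Y \<beta> = (\<Prod>p\<in>primes_upto Y. local_sum (\<beta> / 2) (1 / real p))"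
  unfolding J_def local_sum_def using tendsto_Lim[OF _ euler_moment_avg_tendsto]
  by (simp add: power_divide)

text \<open>Each local sum splits into a factor of the convergent product and a power of 1 - 1 / p,
  so the growth in Y is confined to the sum in Mertens' theorem.\<close>

lemma J_eq_exp:
  "J Y \<beta> = (\<Prod>p\<in>primes_upto Y. local_factor (\<beta> / 2) p) *
     exp (\<beta>\<^sup>2 / 4 * (\<Sum>p\<in>primes_upto Y. - ln (1 - 1 / real p)))"
proof -
  have "local_sum (\<beta> / 2) (1 / real p) =
      local_factor (\<beta> / 2) p * exp (\<beta>\<^sup>2 / 4 * - ln (1 - 1 / real p))"
    if "p \<in> primes_upto Y" for p
  proof -
    have p: "prime p" using that by (simp add: primes_upto_def)
    hence "1 - 1 / real p \<noteq> 0" using prime_gt_1_nat[of p] by auto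
    hence "(1 - 1 / real p) powr (\<beta> / 2)\<^sup>2 = exp (\<beta>\<^sup>2 / 4 * ln (1 - 1 / real p))"
      by (simp add: powr_def power_divide)
    thus ?thesis using p by (simp add: local_factor_def exp_minus)
  qed
  thus ?thesis
    unfolding J_eq by (simp add: prod.distrib sum_distrib_left exp_sum finite_primes_upto)
qed

theorem proposition1:
  fixes \<beta> :: real
  assumes "\<beta> \<ge> 0"
  shows "(\<forall>Y. (euler_moment_avg Y \<beta> \<longlongrightarrow> J Y \<beta>) at_top) \<and>
         (\<lambda>Y. J Y \<beta>) \<sim>[at_top] (\<lambda>Y. a_const \<beta> * (exp euler_mascheroni * ln Y) powr (\<beta>\<^sup>2 / 4))"
proof (intro conjI allI)
  \<comment> \<open>\<open>J\<close> is defined through \<open>Lim\<close>, which by itself does not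
    assert convergence.\<close>
  show "(euler_moment_avg Y \<beta> \<longlongrightarrow> J Y \<beta>) at_top" for Y
    using euler_moment_avg_tendsto[of Y \<beta>] unfolding J_eq local_sum_def by (simp add: power_divide)
  let ?P = "\<lambda>Y. \<Prod>p\<in>primes_upto Y. local_factor (\<beta> / 2) p"
  let ?S = "\<lambda>Y. \<Sum>p\<in>primes_upto Y. - ln (1 - 1 / real p)"
  \<comment> \<open>The quotient of the two sides, with the logarithm of the Mertens product and
    that of its main term collected in one exponent.\<close>
  have "((\<lambda>Y. ?P Y / a_const \<beta> * exp (\<beta>\<^sup>2 / 4 * ((?S Y - ln (ln Y)) - euler_mascheroni)))
      \<longlongrightarrow> a_const \<beta> / a_const \<beta> * exp (\<beta>\<^sup>2 / 4 * (euler_mascheroni - euler_mascheroni))) at_top"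
    using a_const_nonzero by (intro tendsto_intros local_factor_prod_tendsto mertens_third) auto
  hence lim: "((\<lambda>Y. ?P Y / a_const \<beta> * exp (\<beta>\<^sup>2 / 4 * ((?S Y - ln (ln Y)) - euler_mascheroni)))
      \<longlongrightarrow> 1) at_top"
    using a_const_nonzero by simp
  show "(\<lambda>Y. J Y \<beta>) \<sim>[at_top] (\<lambda>Y. a_const \<beta> * (exp euler_mascheroni * ln Y) powr (\<beta>\<^sup>2 / 4))"
  proof (rule asymp_equivI', rule Lim_transform_eventually[OF lim])
    show "\<forall>\<^sub>F Y in at_top. ?P Y / a_const \<beta> * exp (\<beta>\<^sup>2 / 4 * ((?S Y - ln (ln Y)) - euler_mascheroni)) =
        J Y \<beta> / (a_const \<beta> * (exp euler_mascheroni * ln Y) powr (\<beta>\<^sup>2 / 4))"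
      using eventually_gt_at_top[of 1]
    proof eventually_elim
      case (elim Y)
      hence lnY: "ln Y > 0" by simp
      hence "(exp euler_mascheroni * ln Y) powr (\<beta>\<^sup>2 / 4) = exp (\<beta>\<^sup>2 / 4 * (euler_mascheroni + ln (ln Y)))"
        by (simp add: powr_def ln_mult_pos)
      moreover have "k * ((s - l) - g) = k * s - k * (g + l)" for k s l g :: real
        by (simp add: algebra_simps)
      ultimately show ?case by (simp only: J_eq_exp times_divide_times_eq exp_diff)
    qed
  qed
qed

end
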